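(* Let $n\ge 1$ and $t_1,t_2,t_3>0$, and let $g_{(t_1,t_2,t_3)}$ be the homogeneous metric on $\mathbb{S}^{4n+3}$ obtained from the round metric of constant curvature $1$ by modifying it on the fibers of the Hopf fibration $\mathbb{S}^3\to\mathbb{S}^{4n+3}\to\mathbb{HP}^n$ by the diagonal left invariant metric with lengths squared $t_1,t_2,t_3$. For each cyclic permutation $(i,j,k)$ of $(1,2,3)$ put $$V_i=\frac{t_j^2+t_k^2-3t_i^2+2t_it_j+2t_it_k-2t_jt_k}{t_i},\qquad H_i=4-3t_i.$$ Then $g_{(t_1,t_2,t_3)}$ has positive sectional curvature if and only if, for every cyclic permutation $(i,j,k)$ of $(1,2,3)$, $$V_i>0,\qquad H_i>0,\qquad\text{and}\qquad 3\,|t_jt_k-t_j-t_k+t_i|<t_jt_k+\sqrt{H_iV_i}.$$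
   Context: Regard $\mathbb{S}^{4n+3}$ as the unit sphere in $\mathbb{H}^{n+1}$ with its round metric $g$ of constant curvature $1$; the group $Sp(n+1)$ acts transitively by left matrix multiplication on column vectors. The Hopf fibration $\mathbb{S}^3\to\mathbb{S}^{4n+3}\to\mathbb{HP}^n$ has as fibers the orbits of right scalar multiplication by unit quaternions. With $\mathbf{i},\mathbf{j},\mathbf{k}$ the standard imaginary quaternion units, the vector fields $X_1(v)=v\,\mathbf{i}$, $X_2(v)=v\,\mathbf{j}$, $X_3(v)=v\,\mathbf{k}$ are $Sp(n+1)$-invariant and form, at each $v\in\mathbb{S}^{4n+3}$, a $g$-orthonormal basis of the tangent space of the fiber. The metric $g_{(t_1,t_2,t_3)}$ is the $Sp(n+1)$-invariant Riemannian metric on $\mathbb{S}^{4n+3}$ such that: it agrees with $g$ on the $g$-orthogonal complement of the tangent space of the fiber; this complement and the tangent space of the fiber are orthogonal; and $X_1,X_2,X_3$ are mutually orthogonal with $|X_r|^2=t_r$ for $r=1,2,3$. In particular $g_{(1,1,1)}=g$. *)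

theory Defs
  imports "HOL-Analysis.Analysis"
begin

section \<open>Calculus on the unit sphere of a Euclidean space\<close>

text \<open>On an open set of a finite-dimensional space, the following says that all iterated
  directional derivatives exist and are continuous, i.e. that the function is of class
  $C^k$, respectively $C^\infty$.\<close>

primrec Ck_on :: "nat \<Rightarrow> 'a set \<Rightarrow> ('a::real_normed_vector \<Rightarrow> 'b::real_normed_vector) \<Rightarrow> bool" where
  "Ck_on 0 S f \<longleftrightarrow> continuous_on S f"
| "Ck_on (Suc k) S f \<longleftrightarrow> (\<forall>x\<in>S. f differentiable (at x)) \<and>
     (\<forall>v. Ck_on k S (\<lambda>x. frechet_derivative f (at x) v))"

definition smooth_on :: "'a set \<Rightarrow> ('a::real_normed_vector \<Rightarrow> 'b::real_normed_vector) \<Rightarrow> bool" where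
  "smooth_on S f \<longleftrightarrow> (\<forall>k. Ck_on k S f)"

text \<open>Functions and vector fields on the unit sphere are represented by functions on the whole
  ambient space whose values off the sphere are irrelevant. To differentiate them,
  only the values on the sphere are used: these are extended to the complement of the origin
  by composing with the radial projection \<^term>\<open>sgn\<close>, that is, $w \mapsto w / |w|$.\<close>

definition smooth_on_sphere :: "('a::euclidean_space \<Rightarrow> 'b::real_normed_vector) \<Rightarrow> bool" where
  "smooth_on_sphere f \<longleftrightarrow> smooth_on (- {0}) (\<lambda>w. f (sgn w))"

definition vector_field :: "('a::euclidean_space \<Rightarrow> 'a) \<Rightarrow> bool" where
  "vector_field X \<longleftrightarrow> smooth_on_sphere X \<and> (\<forall>v\<in>sphere 0 1. X v \<bullet> v = 0)"

definition deriv_along :: "('a::euclidean_space \<Rightarrow> 'a) \<Rightarrow> ('a \<Rightarrow> 'b::real_normed_vector) \<Rightarrow> 'a \<Rightarrow> 'b" where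
  "deriv_along X f = (\<lambda>v. frechet_derivative (\<lambda>w. f (sgn w)) (at v) (X v))"

definition lie_bracket :: "('a::euclidean_space \<Rightarrow> 'a) \<Rightarrow> ('a \<Rightarrow> 'a) \<Rightarrow> 'a \<Rightarrow> 'a" where
  "lie_bracket X Y = (\<lambda>v. deriv_along X Y v - deriv_along Y X v)"


section \<open>Levi-Civita connection and sectional curvature of a metric on the sphere\<close>

text \<open>A metric \<open>g\<close> assigns to \<open>v\<close> on the sphere and to two tangent vectors \<open>x\<close>, \<open>y\<close> at \<open>v\<close>
  the number \<open>g v x y\<close>.\<close>

type_synonym 'a metric = "'a \<Rightarrow> 'a \<Rightarrow> 'a \<Rightarrow> real"

type_synonym 'a connection = "('a \<Rightarrow> 'a) \<Rightarrow> ('a \<Rightarrow> 'a) \<Rightarrow> 'a \<Rightarrow> 'a"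

definition affine_connection :: "'a::euclidean_space connection \<Rightarrow> bool" where
  "affine_connection D \<longleftrightarrow>
     (\<forall>X Y. vector_field X \<longrightarrow> vector_field Y \<longrightarrow> vector_field (D X Y)) \<and>
     (\<forall>X Y Z. vector_field X \<longrightarrow> vector_field Y \<longrightarrow> vector_field Z \<longrightarrow>
        (\<forall>v\<in>sphere 0 1. D (\<lambda>w. X w + Y w) Z v = D X Z v + D Y Z v
                       \<and> D Z (\<lambda>w. X w + Y w) v = D Z X v + D Z Y v)) \<and>
     (\<forall>(f::'a \<Rightarrow> real) X Y. smooth_on_sphere f \<longrightarrow> vector_field X \<longrightarrow> vector_field Y \<longrightarrow>
        (\<forall>v\<in>sphere 0 1. D (\<lambda>w. f w *\<^sub>R X w) Y v = f v *\<^sub>R D X Y v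
                       \<and> D X (\<lambda>w. f w *\<^sub>R Y w) v = deriv_along X f v *\<^sub>R Y v + f v *\<^sub>R D X Y v))"

definition is_levi_civita :: "'a::euclidean_space metric \<Rightarrow> 'a connection \<Rightarrow> bool" where
  "is_levi_civita g D \<longleftrightarrow> affine_connection D \<and>
     (\<forall>X Y. vector_field X \<longrightarrow> vector_field Y \<longrightarrow>
        (\<forall>v\<in>sphere 0 1. D X Y v - D Y X v = lie_bracket X Y v)) \<and>
     (\<forall>X Y Z. vector_field X \<longrightarrow> vector_field Y \<longrightarrow> vector_field Z \<longrightarrow>
        (\<forall>v\<in>sphere 0 1. deriv_along X (\<lambda>w. g w (Y w) (Z w)) v
            = g v (D X Y v) (Z v) + g v (Y v) (D X Z v)))"

text \<open>For a Riemannian metric, two connections satisfying \<^const>\<open>is_levi_civita\<close> agree on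
  vector fields at points of the sphere; off the sphere and on functions that are not vector
  fields nothing is prescribed, hence \<open>SOME\<close> and not \<open>THE\<close>. The curvature below does not
  depend on this choice.\<close>

definition levi_civita :: "'a::euclidean_space metric \<Rightarrow> 'a connection" where
  "levi_civita g = (SOME D. is_levi_civita g D)"

definition curvature_tensor ::
    "'a::euclidean_space metric \<Rightarrow> ('a \<Rightarrow> 'a) \<Rightarrow> ('a \<Rightarrow> 'a) \<Rightarrow> ('a \<Rightarrow> 'a) \<Rightarrow> 'a \<Rightarrow> 'a" where
  "curvature_tensor g X Y Z =
     (let D = levi_civita g
      in (\<lambda>v. D X (D Y Z) v - D Y (D X Z) v - D (lie_bracket X Y) Z v))"

text \<open>The sectional curvature of the plane spanned by \<open>X v\<close> and \<open>Y v\<close>.\<close>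

definition sectional_curvature ::
    "'a::euclidean_space metric \<Rightarrow> ('a \<Rightarrow> 'a) \<Rightarrow> ('a \<Rightarrow> 'a) \<Rightarrow> 'a \<Rightarrow> real" where
  "sectional_curvature g X Y v =
     g v (curvature_tensor g X Y Y v) (X v)
       / (g v (X v) (X v) * g v (Y v) (Y v) - (g v (X v) (Y v))\<^sup>2)"

text \<open>Every tangent vector of the sphere is the value of a vector field, so all tangent planes
  are covered.\<close>

definition positive_sectional_curvature :: "'a::euclidean_space metric \<Rightarrow> bool" where
  "positive_sectional_curvature g \<longleftrightarrow>
     (\<forall>X Y. vector_field X \<longrightarrow> vector_field Y \<longrightarrow>
        (\<forall>v\<in>sphere 0 1. X v \<noteq> Y v \<and> independent {X v, Y v} \<longrightarrow>
            sectional_curvature g X Y v > 0))"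


section \<open>Quaternions and the Hopf fibration\<close>

text \<open>The quadruple \<open>(a, b, c, d)\<close> stands for $a + b i + c j + d k$. The product type already
  carries the standard inner product, and so does \<open>quat ^ 'm\<close>.\<close>

type_synonym quat = "real \<times> real \<times> real \<times> real"

definition qmult :: "quat \<Rightarrow> quat \<Rightarrow> quat" (infixl "\<star>" 70) where
  "p \<star> q = (case (p, q) of ((a, b, c, d), (a', b', c', d')) \<Rightarrow>
     (a * a' - b * b' - c * c' - d * d',
      a * b' + b * a' + c * d' - d * c',
      a * c' - b * d' + c * a' + d * b',
      a * d' + b * c' - c * b' + d * a'))"

definition qi :: quat where "qi = (0, 1, 0, 0)"
definition qj :: quat where "qj = (0, 0, 1, 0)"
definition qk :: quat where "qk = (0, 0, 0, 1)"

definition right_mult :: "quat ^ 'm \<Rightarrow> quat \<Rightarrow> quat ^ 'm" where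
  "right_mult v q = (\<chi> a. v $ a \<star> q)"

definition fiber_field :: "quat \<Rightarrow> quat ^ 'm \<Rightarrow> quat ^ 'm" where
  "fiber_field u = (\<lambda>v. right_mult v u)"

abbreviation X1 :: "quat ^ 'm \<Rightarrow> quat ^ 'm" where "X1 \<equiv> fiber_field qi"
abbreviation X2 :: "quat ^ 'm \<Rightarrow> quat ^ 'm" where "X2 \<equiv> fiber_field qj"
abbreviation X3 :: "quat ^ 'm \<Rightarrow> quat ^ 'm" where "X3 \<equiv> fiber_field qk"

text \<open>Orthogonal projection to the complement of the tangent space of the fiber through \<open>v\<close>,
  where \<open>v\<close> is on the sphere.\<close>

definition horizontal_part :: "quat ^ 'm \<Rightarrow> quat ^ 'm \<Rightarrow> quat ^ ('m::finite)" where
  "horizontal_part v x =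
     x - (x \<bullet> X1 v) *\<^sub>R X1 v - (x \<bullet> X2 v) *\<^sub>R X2 v - (x \<bullet> X3 v) *\<^sub>R X3 v"

definition hopf_metric :: "real \<Rightarrow> real \<Rightarrow> real \<Rightarrow> (quat ^ ('m::finite)) metric" where
  "hopf_metric t1 t2 t3 v x y =
     horizontal_part v x \<bullet> horizontal_part v y
     + t1 * (x \<bullet> X1 v) * (y \<bullet> X1 v)
     + t2 * (x \<bullet> X2 v) * (y \<bullet> X2 v)
     + t3 * (x \<bullet> X3 v) * (y \<bullet> X3 v)"


definition V_coeff :: "real \<Rightarrow> real \<Rightarrow> real \<Rightarrow> real" where
  "V_coeff ti tj tk =
     (tj\<^sup>2 + tk\<^sup>2 - 3 * ti\<^sup>2 + 2 * ti * tj + 2 * ti * tk - 2 * tj * tk) / ti"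

definition H_coeff :: "real \<Rightarrow> real" where
  "H_coeff ti = 4 - 3 * ti"


subsection \<open>The metric is the one prescribed on the fibers and their complement\<close>

lemma fiber_field_tangent: "X1 v \<bullet> v = 0" "X2 v \<bullet> v = 0" "X3 v \<bullet> v = 0"
  for v :: "quat ^ ('m::finite)"
  by (auto simp: fiber_field_def right_mult_def inner_vec_def qmult_def qi_def qj_def qk_def
      inner_prod_def algebra_simps split: prod.splits intro!: sum.neutral)

lemma fiber_field_orthogonal: "X1 v \<bullet> X2 v = 0" "X1 v \<bullet> X3 v = 0" "X2 v \<bullet> X3 v = 0"
  for v :: "quat ^ ('m::finite)"
  by (auto simp: fiber_field_def right_mult_def inner_vec_def qmult_def qi_def qj_def qk_def
      inner_prod_def algebra_simps split: prod.splits intro!: sum.neutral)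

lemma fiber_field_inner_self: "X1 v \<bullet> X1 v = v \<bullet> v" "X2 v \<bullet> X2 v = v \<bullet> v" "X3 v \<bullet> X3 v = v \<bullet> v"
  for v :: "quat ^ ('m::finite)"
  by (auto simp: fiber_field_def right_mult_def inner_vec_def qmult_def qi_def qj_def qk_def
      inner_prod_def algebra_simps split: prod.splits intro!: sum.cong)

lemma fiber_field_unit:
  fixes v :: "quat ^ ('m::finite)"
  assumes "v \<in> sphere 0 1"
  shows "X1 v \<bullet> X1 v = 1" "X2 v \<bullet> X2 v = 1" "X3 v \<bullet> X3 v = 1"
  using assms by (simp_all only: fiber_field_inner_self) (simp_all add: dot_square_norm)

lemma hopf_metric_properties:
  fixes v :: "quat ^ ('m::finite)"
  assumes v: "v \<in> sphere 0 1"
  shows "hopf_metric t1 t2 t3 v (X1 v) (X1 v) = t1"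
    and "hopf_metric t1 t2 t3 v (X2 v) (X2 v) = t2"
    and "hopf_metric t1 t2 t3 v (X3 v) (X3 v) = t3"
    and "hopf_metric t1 t2 t3 v (X1 v) (X2 v) = 0"
    and "hopf_metric t1 t2 t3 v (X1 v) (X3 v) = 0"
    and "hopf_metric t1 t2 t3 v (X2 v) (X3 v) = 0"
    and "x \<bullet> X1 v = 0 \<Longrightarrow> x \<bullet> X2 v = 0 \<Longrightarrow> x \<bullet> X3 v = 0 \<Longrightarrow>
         y \<bullet> X1 v = 0 \<Longrightarrow> y \<bullet> X2 v = 0 \<Longrightarrow> y \<bullet> X3 v = 0 \<Longrightarrow>
         hopf_metric t1 t2 t3 v x y = x \<bullet> y"
    and "x \<bullet> X1 v = 0 \<Longrightarrow> x \<bullet> X2 v = 0 \<Longrightarrow> x \<bullet> X3 v = 0 \<Longrightarrow>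
         y \<in> span {X1 v, X2 v, X3 v} \<Longrightarrow> hopf_metric t1 t2 t3 v x y = 0"
    and "hopf_metric 1 1 1 v x y = x \<bullet> y"
proof -
  note o = fiber_field_unit[OF v] fiber_field_orthogonal[of v]
    fiber_field_orthogonal[of v, unfolded inner_commute[of "X1 v"] inner_commute[of "X2 v" "X3 v"]]
  show "hopf_metric t1 t2 t3 v (X1 v) (X1 v) = t1"
    and "hopf_metric t1 t2 t3 v (X2 v) (X2 v) = t2"
    and "hopf_metric t1 t2 t3 v (X3 v) (X3 v) = t3"
    and "hopf_metric t1 t2 t3 v (X1 v) (X2 v) = 0"
    and "hopf_metric t1 t2 t3 v (X1 v) (X3 v) = 0"
    and "hopf_metric t1 t2 t3 v (X2 v) (X3 v) = 0"
    by (simp_all add: hopf_metric_def horizontal_part_def o)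
  show "hopf_metric t1 t2 t3 v x y = x \<bullet> y"
    if "x \<bullet> X1 v = 0" "x \<bullet> X2 v = 0" "x \<bullet> X3 v = 0" "y \<bullet> X1 v = 0" "y \<bullet> X2 v = 0" "y \<bullet> X3 v = 0"
    using that by (simp add: hopf_metric_def horizontal_part_def)
  show "hopf_metric t1 t2 t3 v x y = 0"
    if h: "x \<bullet> X1 v = 0" "x \<bullet> X2 v = 0" "x \<bullet> X3 v = 0" and y: "y \<in> span {X1 v, X2 v, X3 v}"
  proof -
    obtain a b c where "y = a *\<^sub>R X1 v + b *\<^sub>R X2 v + c *\<^sub>R X3 v"
      using y by (auto simp: span_breakdown_eq algebra_simps)
    then show ?thesis
      using h by (simp add: hopf_metric_def horizontal_part_def o algebra_simps)
  qed
  show "hopf_metric 1 1 1 v x y = x \<bullet> y"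
    by (simp add: hopf_metric_def horizontal_part_def o inner_diff_left inner_diff_right
        inner_commute[of _ y] algebra_simps)
qed

end

theory Submission
  imports Defs
begin

text \<open>
Why the theorem holds. The metric differs from the round one only through the three one-forms
\<open>\<theta>_r = \<langle>\<cdot>, X_r\<rangle>\<close>. The fields \<open>X_r\<close> are Killing for the round metric, so the round covariant
derivative of \<open>\<theta>_r\<close> is the skew form \<open>(x, y) \<mapsto> \<langle>y, X_r x\<rangle>\<close>, where \<open>X_r x\<close> is right multiplication of
\<open>x\<close> by a quaternion unit. Hence the Koszul formula can be solved explicitly: the
Levi-Civita connection is the round one plus a tensor \<open>S\<close> that is polynomial in the point
(\<open>hopf_metric_christoffel\<close>, \<open>levi_civita_hopf_metric\<close>). Since second derivatives commute, every
derivative of the fields cancels in the curvature tensor, and what remains is algebra in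
the values of the fields at one point (\<open>curvature_tensor_hopf_metric\<close>).

For tangent vectors \<open>x = h + \<Sum> a_r X_r\<close> and \<open>y = k + \<Sum> b_r X_r\<close> with \<open>h\<close>, \<open>k\<close> horizontal, write
\<open>A = a \<times> b\<close>, \<open>O_r = \<langle>k, X_r h\<rangle>\<close> and \<open>\<tau>_i = t_j t_k - t_j - t_k + t_i\<close>. The outcome
(\<open>hopf_curvature_formula\<close>) is
\[ g(R(x,y)y,x) = |h\wedge k|^2 + \sum_r \left( 3(1-t_r) O_r^2 + V_r A_r^2 + 6\tau_r A_r O_r
   + t_r^2\, |a_r k - b_r h|^2 \right). \]

Two inequalities make this positive. The vectors \<open>h, X_1 h, X_2 h, X_3 h\<close> are orthogonal and of
equal length, so \<open>|h\<and>k|\<^sup>2 \<ge> \<Sum> O_r\<^sup>2\<close> (\<open>quaternionic_Bessel\<close>), which turns the coefficient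
\<open>3 (1 - t_r)\<close> into \<open>H_r = 4 - 3 t_r\<close>. With \<open>p = (t_r a_r)\<close> and \<open>q = (t_r b_r)\<close> the last sum is
the squared norm of the tensor \<open>h \<otimes> q - k \<otimes> p\<close>. It is at least \<open>2 |h\<and>k| |p\<and>q|\<close>, hence at least
\<open>2 \<Sum> t_j t_k |A_i O_i|\<close> (\<open>mixed_term_bound\<close>). So the curvature is bounded below by a sum of three
binary forms \<open>V_i A\<^sup>2 + H_i O\<^sup>2 + 6 \<tau>_i A O + 2 t_j t_k |A O|\<close>, and the condition of the theorem says
precisely that these are positive definite.

Conversely let \<open>e\<close> be a horizontal unit vector. Both inequalities are equalities on the planes spanned by
\<open>e + c t_k X_j\<close> and \<open>\<plusminus> X_i e + c t_j X_k\<close>, where only the \<open>i\<close>-th binary form contributes. Together with the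
planes spanned by \<open>X_j\<close> and \<open>X_k\<close> they show that each condition is necessary.
\<close>

section \<open>Smooth functions on open sets\<close>

lemma Ck_on_cong:
  assumes "open S" "\<And>x. x \<in> S \<Longrightarrow> f x = g x" "Ck_on k S f"
  shows "Ck_on k S g"
  using assms(2,3)
proof (induction k arbitrary: f g)
  case 0
  then show ?case by (metis Ck_on.simps(1) continuous_on_cong)
next
  case (Suc k)
  have d: "f differentiable (at x)" if "x \<in> S" for x
    using Suc.prems that by simp
  have 1: "g differentiable (at x)" if "x \<in> S" for x
    using d[OF that] Suc.prems(1) assms(1) that
    by (meson differentiable_def has_derivative_transform_within_open)
  have 2: "frechet_derivative f (at x) = frechet_derivative g (at x)" if "x \<in> S" for x
    using d[OF that] Suc.prems(1) assms(1) that
    by (intro frechet_derivative_transform_within_open[of f x S g]) auto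
  have "Ck_on k S (\<lambda>x. frechet_derivative g (at x) v)" for v
    by (rule Suc.IH[of "\<lambda>x. frechet_derivative f (at x) v"]) (use 2 Suc.prems in auto)
  with 1 show ?case by simp
qed

lemma Ck_on_SucI:
  assumes "open S" "\<And>x. x \<in> S \<Longrightarrow> (f has_derivative f' x) (at x)" "\<And>v. Ck_on k S (\<lambda>x. f' x v)"
  shows "Ck_on (Suc k) S f"
proof -
  have "Ck_on k S (\<lambda>x. frechet_derivative f (at x) v)" for v
    by (rule Ck_on_cong[OF assms(1) _ assms(3)[of v]]) (use assms(2) frechet_derivative_at in metis)
  then show ?thesis using assms(2) by (auto simp: differentiable_def)
qed

lemma Ck_on_SucD: "Ck_on (Suc k) S f \<Longrightarrow> Ck_on k S f"
proof (induction k arbitrary: f)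
  case 0
  then show ?case
    by (auto intro!: continuous_at_imp_continuous_on differentiable_imp_continuous_within)
next
  case (Suc k)
  then show ?case by simp
qed

lemma Ck_on_Suc_has_derivative:
  assumes "Ck_on (Suc k) S f" "x \<in> S"
  shows "(f has_derivative frechet_derivative f (at x)) (at x)"
  using assms frechet_derivative_works by auto

lemma Ck_on_const: "Ck_on k S (\<lambda>x. c)"
  by (induction k arbitrary: c) auto

lemma Ck_on_add:
  assumes "open S" "Ck_on k S f" "Ck_on k S g"
  shows "Ck_on k S (\<lambda>x. f x + g x)"
  using assms(2,3)
proof (induction k arbitrary: f g)
  case 0
  then show ?case by (auto intro: continuous_intros)
next
  case (Suc k)
  show ?case
  proof (rule Ck_on_SucI[OF assms(1)])
    show "((\<lambda>x. f x + g x) has_derivative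
      (\<lambda>v. frechet_derivative f (at x) v + frechet_derivative g (at x) v)) (at x)" if "x \<in> S" for x
      using Suc.prems that by (intro has_derivative_add Ck_on_Suc_has_derivative)
    show "Ck_on k S (\<lambda>x. frechet_derivative f (at x) v + frechet_derivative g (at x) v)" for v
      using Suc.prems by (intro Suc.IH) auto
  qed
qed

lemma (in bounded_bilinear) Ck_on:
  assumes "open S" "Ck_on k S f" "Ck_on k S g"
  shows "Ck_on k S (\<lambda>x. prod (f x) (g x))"
  using assms(2,3)
proof (induction k arbitrary: f g)
  case 0
  then show ?case by (auto intro: continuous_on)
next
  case (Suc k)
  show ?case
  proof (rule Ck_on_SucI[OF assms(1)])
    show "((\<lambda>x. prod (f x) (g x)) has_derivative
      (\<lambda>v. prod (f x) (frechet_derivative g (at x) v) + prod (frechet_derivative f (at x) v) (g x))) (at x)"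
      if "x \<in> S" for x
      using Suc.prems that by (intro FDERIV Ck_on_Suc_has_derivative)
    show "Ck_on k S (\<lambda>x. prod (f x) (frechet_derivative g (at x) v)
      + prod (frechet_derivative f (at x) v) (g x))" for v
      using Suc.prems(1,2) by (intro Ck_on_add[OF assms(1)] Suc.IH)
        (simp_all only: Ck_on_SucD, simp_all)
  qed
qed

lemma Ck_on_bounded_linear:
  assumes "open S" "bounded_linear L" "Ck_on k S f"
  shows "Ck_on k S (\<lambda>x. L (f x))"
  using assms(3)
proof (induction k arbitrary: f)
  case 0
  then show ?case using assms(2) by (auto intro: bounded_linear.continuous_on)
next
  case (Suc k)
  show ?case
  proof (rule Ck_on_SucI[OF assms(1)])
    show "((\<lambda>x. L (f x)) has_derivative (\<lambda>v. L (frechet_derivative f (at x) v))) (at x)" if "x \<in> S" for x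
      by (rule bounded_linear.has_derivative[OF assms(2) Ck_on_Suc_has_derivative[OF Suc.prems that]])
    show "Ck_on k S (\<lambda>x. L (frechet_derivative f (at x) v))" for v
      using Suc.prems by (intro Suc.IH) auto
  qed
qed

lemma Ck_on_ident: "open S \<Longrightarrow> Ck_on k S (\<lambda>x. x)"
proof (cases k)
  case (Suc j)
  assume "open S"
  then show ?thesis unfolding Suc
    by (intro Ck_on_SucI[where f' = "\<lambda>x v. v"]) (auto intro: Ck_on_const)
qed auto

text \<open>The norm and its inverse have to be treated together: the derivative of each is a polynomial in both
(and in the point), so the induction on the order of differentiability closes up.\<close>

lemma Ck_on_norm_inverse_norm:
  fixes S :: "'a::real_inner set"
  assumes "open S" "0 \<notin> S"
  shows "Ck_on k S norm \<and> Ck_on k S (\<lambda>x. inverse (norm x))"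
proof (induction k)
  case 0
  then show ?case using assms by (auto intro!: continuous_intros)
next
  case (Suc k)
  note bil = bounded_bilinear.Ck_on[OF bounded_bilinear_mult] bounded_bilinear.Ck_on[OF bounded_bilinear_inner]
  have N: "(norm has_derivative (\<lambda>v. (x \<bullet> v) * inverse (norm x))) (at x)" if "x \<in> S" for x
    using has_derivative_norm[of x] that assms(2)
    by (auto simp: sgn_div_norm inner_commute mult.commute intro!: has_derivative_eq_rhs[OF has_derivative_norm])
  show ?case
  proof
    show "Ck_on (Suc k) S norm"
      by (rule Ck_on_SucI[OF assms(1) N])
        (use Suc assms in \<open>auto intro!: bil Ck_on_const Ck_on_ident\<close>)
    have M: "((\<lambda>x. inverse (norm x)) has_derivative
        (\<lambda>v. (- 1) * ((x \<bullet> v) * (inverse (norm x) * (inverse (norm x) * inverse (norm x)))))) (at x)" if "x \<in> S" for x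
      by (rule has_derivative_eq_rhs[OF Deriv.has_derivative_inverse[OF _ N[OF that]]])
        (use that assms(2) in \<open>auto simp: fun_eq_iff\<close>)
    have "Ck_on k S (\<lambda>x. (- 1) * ((x \<bullet> v) * (inverse (norm x) * (inverse (norm x) * inverse (norm x)))))" for v
      by (intro bil Ck_on_const Ck_on_ident; use Suc assms in blast)
    then show "Ck_on (Suc k) S (\<lambda>x. inverse (norm x))"
      by (intro Ck_on_SucI[OF assms(1) M])
  qed
qed

lemma smooth_on_cong:
  "open S \<Longrightarrow> smooth_on S f \<Longrightarrow> (\<And>x. x \<in> S \<Longrightarrow> f x = g x) \<Longrightarrow> smooth_on S g"
  unfolding smooth_on_def using Ck_on_cong by blast

lemma smooth_on_const: "smooth_on S (\<lambda>x. c)"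
  by (simp add: smooth_on_def Ck_on_const)

lemma smooth_on_ident: "open S \<Longrightarrow> smooth_on S (\<lambda>x. x)"
  by (simp add: smooth_on_def Ck_on_ident)

lemma smooth_on_add: "open S \<Longrightarrow> smooth_on S f \<Longrightarrow> smooth_on S g \<Longrightarrow> smooth_on S (\<lambda>x. f x + g x)"
  by (simp add: smooth_on_def Ck_on_add)

lemma smooth_on_bounded_linear: "open S \<Longrightarrow> bounded_linear L \<Longrightarrow> smooth_on S f \<Longrightarrow> smooth_on S (\<lambda>x. L (f x))"
  by (simp add: smooth_on_def Ck_on_bounded_linear)

lemma smooth_on_diff: "open S \<Longrightarrow> smooth_on S f \<Longrightarrow> smooth_on S g \<Longrightarrow> smooth_on S (\<lambda>x. f x - g x)"
  using smooth_on_add[of S f "\<lambda>x. - g x"] smooth_on_bounded_linear[of S uminus g]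
  by (simp add: bounded_linear_minus bounded_linear_ident)

lemma smooth_on_scaleR: "open S \<Longrightarrow> smooth_on S f \<Longrightarrow> smooth_on S g \<Longrightarrow> smooth_on S (\<lambda>x. f x *\<^sub>R g x)"
  by (simp add: smooth_on_def bounded_bilinear.Ck_on[OF bounded_bilinear_scaleR])

lemma smooth_on_mult:
  fixes f g :: "'a::real_normed_vector \<Rightarrow> real"
  shows "open S \<Longrightarrow> smooth_on S f \<Longrightarrow> smooth_on S g \<Longrightarrow> smooth_on S (\<lambda>x. f x * g x)"
  using smooth_on_scaleR[of S f g] by simp

lemma smooth_on_inner: "open S \<Longrightarrow> smooth_on S f \<Longrightarrow> smooth_on S g \<Longrightarrow> smooth_on S (\<lambda>x. f x \<bullet> g x)"
  by (simp add: smooth_on_def bounded_bilinear.Ck_on[OF bounded_bilinear_inner])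

lemma smooth_on_sum:
  "open S \<Longrightarrow> (\<And>i. i \<in> I \<Longrightarrow> smooth_on S (f i)) \<Longrightarrow> smooth_on S (\<lambda>x. \<Sum>i\<in>I. f i x)"
  by (induction I rule: infinite_finite_induct) (auto intro: smooth_on_const smooth_on_add)

lemma smooth_on_norm: "smooth_on (- {0::'a::real_inner}) norm"
  and smooth_on_sgn: "smooth_on (- {0::'a::real_inner}) sgn"
proof -
  have *: "open (- {0::'a})" "0 \<notin> - {0::'a}" by auto
  show "smooth_on (- {0::'a}) norm"
    using Ck_on_norm_inverse_norm[OF *] by (simp add: smooth_on_def)
  have "smooth_on (- {0::'a}) (\<lambda>x. inverse (norm x) *\<^sub>R x)"
    using Ck_on_norm_inverse_norm[OF *]
    by (intro smooth_on_scaleR * smooth_on_ident) (simp add: smooth_on_def)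
  then show "smooth_on (- {0::'a}) sgn" by (simp add: sgn_div_norm[abs_def])
qed

lemma smooth_on_has_derivative:
  "smooth_on S f \<Longrightarrow> x \<in> S \<Longrightarrow> (f has_derivative frechet_derivative f (at x)) (at x)"
  unfolding smooth_on_def using Ck_on_Suc_has_derivative by blast

lemma smooth_on_frechet_derivative:
  "smooth_on S f \<Longrightarrow> smooth_on S (\<lambda>x. frechet_derivative f (at x) v)"
  unfolding smooth_on_def by (metis Ck_on.simps(2))

lemma frechet_derivative_eq_sum:
  fixes f :: "'a::euclidean_space \<Rightarrow> 'b::real_normed_vector"
  assumes "(f has_derivative frechet_derivative f (at x)) (at x)"
  shows "frechet_derivative f (at x) u = (\<Sum>b\<in>Basis. (u \<bullet> b) *\<^sub>R frechet_derivative f (at x) b)"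
proof -
  interpret bounded_linear "frechet_derivative f (at x)"
    using assms by (rule has_derivative_bounded_linear)
  have "frechet_derivative f (at x) u = frechet_derivative f (at x) (\<Sum>b\<in>Basis. (u \<bullet> b) *\<^sub>R b)"
    by (simp add: euclidean_representation)
  then show ?thesis by (simp add: sum scaleR)
qed

lemma smooth_on_frechet_derivative_along:
  fixes f :: "'a::euclidean_space \<Rightarrow> 'b::real_normed_vector"
  assumes "open S" "smooth_on S f" "smooth_on S X"
  shows "smooth_on S (\<lambda>x. frechet_derivative f (at x) (X x))"
proof (rule smooth_on_cong[OF assms(1)])
  show "smooth_on S (\<lambda>x. \<Sum>b\<in>Basis. (X x \<bullet> b) *\<^sub>R frechet_derivative f (at x) b)"
    using assms by (intro smooth_on_sum smooth_on_scaleR smooth_on_inner smooth_on_const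
        smooth_on_frechet_derivative)
qed (metis frechet_derivative_eq_sum smooth_on_has_derivative assms(2))

text \<open>The product rule for \<open>y \<mapsto> Df(y)(X y)\<close>. Expanding \<open>X y\<close> in the standard basis reduces it to the
partial derivatives \<open>Df(y) b\<close>, whose differentiability is what smoothness provides.\<close>

lemma has_derivative_frechet_derivative_along:
  fixes f :: "'a::euclidean_space \<Rightarrow> 'b::real_normed_vector"
  assumes "open S" "smooth_on S f" "(X has_derivative X') (at x)" "x \<in> S"
  shows "((\<lambda>y. frechet_derivative f (at y) (X y)) has_derivative
     (\<lambda>u. frechet_derivative (\<lambda>y. frechet_derivative f (at y) (X x)) (at x) u
        + frechet_derivative f (at x) (X' u))) (at x)"
proof -
  let ?F = "\<lambda>b y. frechet_derivative f (at y) b"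
  have d: "(?F b has_derivative frechet_derivative (?F b) (at x)) (at x)" for b
    using assms by (intro smooth_on_has_derivative smooth_on_frechet_derivative)
  have eq: "?F u y = (\<Sum>b\<in>Basis. (u \<bullet> b) *\<^sub>R ?F b y)" if "y \<in> S" for u y
    using frechet_derivative_eq_sum smooth_on_has_derivative assms(2) that by metis
  have 0: "((\<lambda>y. \<Sum>b\<in>Basis. (c \<bullet> b) *\<^sub>R ?F b y) has_derivative
     (\<lambda>u. \<Sum>b\<in>Basis. (c \<bullet> b) *\<^sub>R frechet_derivative (?F b) (at x) u)) (at x)" for c
    by (auto intro!: derivative_eq_intros d)
  have "(?F c has_derivative (\<lambda>u. \<Sum>b\<in>Basis. (c \<bullet> b) *\<^sub>R frechet_derivative (?F b) (at x) u)) (at x)" for c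
    by (rule has_derivative_transform_within_open[OF 0 assms(1,4)]) (metis eq)
  from fun_cong[OF frechet_derivative_at[OF this], symmetric]
  have 1: "frechet_derivative (?F c) (at x) u
      = (\<Sum>b\<in>Basis. (c \<bullet> b) *\<^sub>R frechet_derivative (?F b) (at x) u)" for c u
    .
  have "((\<lambda>y. \<Sum>b\<in>Basis. (X y \<bullet> b) *\<^sub>R ?F b y) has_derivative
     (\<lambda>u. \<Sum>b\<in>Basis. (X x \<bullet> b) *\<^sub>R frechet_derivative (?F b) (at x) u + (X' u \<bullet> b) *\<^sub>R ?F b x)) (at x)"
    by (auto intro!: derivative_eq_intros d assms(3))
  then have "((\<lambda>y. \<Sum>b\<in>Basis. (X y \<bullet> b) *\<^sub>R ?F b y) has_derivative
     (\<lambda>u. frechet_derivative (?F (X x)) (at x) u + ?F (X' u) x)) (at x)"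
    by (simp only: 1[of "X x"] eq[OF assms(4), of "X' _"] sum.distrib)
  then show ?thesis
    by (rule has_derivative_transform_within_open[OF _ assms(1,4)]) (rule eq[symmetric])
qed

text \<open>The mean value theorem applied twice to the second difference over the parallelogram spanned by
\<open>h u\<close> and \<open>h v\<close>. The left-hand side is symmetric in \<open>u\<close> and \<open>v\<close>, the right-hand side is a mixed
derivative at a nearby point; comparing the two orders yields the symmetry of mixed derivatives.\<close>

lemma second_difference_mean_value:
  fixes f :: "'a::real_normed_vector \<Rightarrow> real"
  assumes sm: "smooth_on S f" and ball: "ball x r \<subseteq> S" and h: "0 < h" "h * (norm u + norm v) < r"
  obtains p where "dist x p < r"
    "f (x + h *\<^sub>R u + h *\<^sub>R v) - f (x + h *\<^sub>R u) - f (x + h *\<^sub>R v) + f x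
     = h\<^sup>2 * frechet_derivative (\<lambda>y. frechet_derivative f (at y) u) (at p) v"
proof -
  let ?fu = "\<lambda>y. frechet_derivative f (at y) u"
  have near: "dist x (x + s *\<^sub>R u + t *\<^sub>R v) < r" if "0 \<le> s" "s \<le> h" "0 \<le> t" "t \<le> h" for s t
  proof -
    have "dist x (x + s *\<^sub>R u + t *\<^sub>R v) = norm (s *\<^sub>R u + t *\<^sub>R v)"
      unfolding dist_norm by (subst norm_minus_commute) (simp add: add.assoc)
    also have "\<dots> \<le> s * norm u + t * norm v"
      using norm_triangle_ineq[of "s *\<^sub>R u" "t *\<^sub>R v"] that by simp
    also have "\<dots> \<le> h * (norm u + norm v)"
      using that by (simp add: distrib_left add_mono mult_right_mono)
    finally show ?thesis using h by simp
  qed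
  have inS: "x + s *\<^sub>R u + t *\<^sub>R v \<in> S" if "0 \<le> s" "s \<le> h" "0 \<le> t" "t \<le> h" for s t
    using near[OF that] ball by auto
  have du: "((\<lambda>s. f (x + s *\<^sub>R u + t *\<^sub>R v)) has_real_derivative ?fu (x + s *\<^sub>R u + t *\<^sub>R v)) (at s)"
    if "0 \<le> s" "s \<le> h" "0 \<le> t" "t \<le> h" for s t
  proof -
    have "((\<lambda>s. x + s *\<^sub>R u + t *\<^sub>R v) has_vector_derivative u) (at s)"
      by (auto intro!: derivative_eq_intros)
    then show ?thesis
      using vector_derivative_diff_chain_within[of "\<lambda>s. x + s *\<^sub>R u + t *\<^sub>R v" u s UNIV f]
        smooth_on_has_derivative[OF sm inS[OF that]]
      by (auto simp: has_real_derivative_iff_has_vector_derivative o_def has_derivative_at_withinI)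
  qed
  have "((\<lambda>s. f (x + s *\<^sub>R u + h *\<^sub>R v) - f (x + s *\<^sub>R u + 0 *\<^sub>R v)) has_real_derivative
     ?fu (x + s *\<^sub>R u + h *\<^sub>R v) - ?fu (x + s *\<^sub>R u + 0 *\<^sub>R v)) (at s)" if "0 \<le> s" "s \<le> h" for s
    using du[of s h] du[of s 0] that h by (intro DERIV_diff) auto
  from MVT2[OF h(1) this] obtain s where s: "0 < s" "s < h"
    and e1: "f (x + h *\<^sub>R u + h *\<^sub>R v) - f (x + h *\<^sub>R u) - f (x + h *\<^sub>R v) + f x
      = h * (?fu (x + s *\<^sub>R u + h *\<^sub>R v) - ?fu (x + s *\<^sub>R u))"
    by (auto simp: algebra_simps)
  have "((\<lambda>t. ?fu (x + s *\<^sub>R u + t *\<^sub>R v)) has_real_derivative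
      frechet_derivative ?fu (at (x + s *\<^sub>R u + t *\<^sub>R v)) v) (at t)" if "0 \<le> t" "t \<le> h" for t
  proof -
    have "((\<lambda>t. x + s *\<^sub>R u + t *\<^sub>R v) has_vector_derivative v) (at t)"
      by (auto intro!: derivative_eq_intros)
    then show ?thesis
      using vector_derivative_diff_chain_within[of "\<lambda>t. x + s *\<^sub>R u + t *\<^sub>R v" v t UNIV ?fu]
        smooth_on_has_derivative[OF smooth_on_frechet_derivative[OF sm] inS[of s t]] that s
      by (auto simp: has_real_derivative_iff_has_vector_derivative o_def has_derivative_at_withinI)
  qed
  from MVT2[OF h(1) this] obtain t where t: "0 < t" "t < h"
    and e2: "?fu (x + s *\<^sub>R u + h *\<^sub>R v) - ?fu (x + s *\<^sub>R u)
      = h * frechet_derivative ?fu (at (x + s *\<^sub>R u + t *\<^sub>R v)) v"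
    by auto
  show ?thesis
    by (rule that[OF near[of s t]]) (use s t in \<open>auto simp: e1 e2 power2_eq_square\<close>)
qed

lemma mixed_derivatives_commute_real:
  fixes f :: "'a::real_normed_vector \<Rightarrow> real"
  assumes "open S" "smooth_on S f" "x \<in> S"
  shows "frechet_derivative (\<lambda>y. frechet_derivative f (at y) u) (at x) v
       = frechet_derivative (\<lambda>y. frechet_derivative f (at y) v) (at x) u" (is "?A x = ?B x")
proof -
  have "\<bar>?A x - ?B x\<bar> < e" if "e > 0" for e
  proof -
    have ct: "continuous (at x) ?A" "continuous (at x) ?B"
      using assms smooth_on_frechet_derivative[OF smooth_on_frechet_derivative[OF assms(2)]]
      by (metis smooth_on_has_derivative has_derivative_continuous)+
    obtain r where r: "r > 0" "ball x r \<subseteq> S"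
      "\<And>p. dist x p < r \<Longrightarrow> \<bar>?A p - ?A x\<bar> < e/2" "\<And>p. dist x p < r \<Longrightarrow> \<bar>?B p - ?B x\<bar> < e/2"
    proof -
      obtain r1 where "r1 > 0" "\<And>p. dist p x < r1 \<Longrightarrow> \<bar>?A p - ?A x\<bar> < e/2"
        using ct(1)[unfolded continuous_at_eps_delta, rule_format, of "e/2"] \<open>e > 0\<close> by (auto simp: dist_real_def)
      moreover obtain r2 where "r2 > 0" "\<And>p. dist p x < r2 \<Longrightarrow> \<bar>?B p - ?B x\<bar> < e/2"
        using ct(2)[unfolded continuous_at_eps_delta, rule_format, of "e/2"] \<open>e > 0\<close> by (auto simp: dist_real_def)
      moreover obtain r3 where "r3 > 0" "ball x r3 \<subseteq> S"
        using assms openE by blast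
      ultimately show ?thesis
        by (intro that[of "min r1 (min r2 r3)"]) (auto simp: dist_commute)
    qed
    define h where "h = r / (2 * (norm u + norm v + 1))"
    have pos: "norm u + norm v + 1 > 0" by (simp add: add_nonneg_pos)
    have "h > 0" using pos r(1) by (simp add: h_def)
    moreover have "h * (norm u + norm v) < r"
    proof -
      have "h * (2 * (norm u + norm v + 1)) = r" using pos by (simp add: h_def)
      then have "2 * (h * (norm u + norm v)) + 2 * h = r" by (simp add: algebra_simps)
      moreover have "h * (norm u + norm v) \<ge> 0" using \<open>h > 0\<close> by simp
      ultimately show ?thesis using \<open>h > 0\<close> by linarith
    qed
    ultimately have h: "h > 0" "h * (norm u + norm v) < r" .
    from h have h': "h * (norm v + norm u) < r" by (simp add: add.commute)
    \<comment> \<open>the same second difference, with the two directions in either order\<close>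
    obtain p where p: "dist x p < r"
      "f (x + h *\<^sub>R u + h *\<^sub>R v) - f (x + h *\<^sub>R u) - f (x + h *\<^sub>R v) + f x = h\<^sup>2 * ?A p"
      by (rule second_difference_mean_value[OF assms(2) r(2) h])
    obtain q where q: "dist x q < r"
      "f (x + h *\<^sub>R v + h *\<^sub>R u) - f (x + h *\<^sub>R v) - f (x + h *\<^sub>R u) + f x = h\<^sup>2 * ?B q"
      by (rule second_difference_mean_value[OF assms(2) r(2) h(1) h'])
    have "h\<^sup>2 * ?A p = h\<^sup>2 * ?B q"
      unfolding p(2)[symmetric] q(2)[symmetric] by (simp add: algebra_simps)
    then have "?A p = ?B q" using h(1) by simp
    then show ?thesis using r(3)[OF p(1)] r(4)[OF q(1)] by linarith
  qed
  from this[of "\<bar>?A x - ?B x\<bar>"] show ?thesis by fastforce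
qed

lemma mixed_derivatives_commute:
  fixes f :: "'a::real_normed_vector \<Rightarrow> 'b::euclidean_space"
  assumes "open S" "smooth_on S f" "x \<in> S"
  shows "frechet_derivative (\<lambda>y. frechet_derivative f (at y) u) (at x) v
       = frechet_derivative (\<lambda>y. frechet_derivative f (at y) v) (at x) u"
proof (rule euclidean_eqI)
  fix b :: 'b
  have 1: "frechet_derivative (\<lambda>y. f y \<bullet> b) (at y) w = frechet_derivative f (at y) w \<bullet> b" if "y \<in> S" for y w
  proof -
    have "((\<lambda>y. f y \<bullet> b) has_derivative (\<lambda>w. frechet_derivative f (at y) w \<bullet> b)) (at y)"
      by (auto intro!: derivative_eq_intros smooth_on_has_derivative[OF assms(2) that])
    then show ?thesis by (metis frechet_derivative_at)
  qed
  have 2: "frechet_derivative (\<lambda>y. frechet_derivative (\<lambda>y. f y \<bullet> b) (at y) w) (at x) z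
      = frechet_derivative (\<lambda>y. frechet_derivative f (at y) w) (at x) z \<bullet> b" for w z
  proof -
    have "((\<lambda>y. frechet_derivative f (at y) w \<bullet> b) has_derivative
       (\<lambda>z. frechet_derivative (\<lambda>y. frechet_derivative f (at y) w) (at x) z \<bullet> b)) (at x)"
      by (auto intro!: derivative_eq_intros smooth_on_has_derivative[OF smooth_on_frechet_derivative[OF assms(2)] assms(3)])
    then have "((\<lambda>y. frechet_derivative (\<lambda>y. f y \<bullet> b) (at y) w) has_derivative
       (\<lambda>z. frechet_derivative (\<lambda>y. frechet_derivative f (at y) w) (at x) z \<bullet> b)) (at x)"
      by (rule has_derivative_transform_within_open[OF _ assms(1,3)]) (simp add: 1)
    then show ?thesis by (metis frechet_derivative_at)
  qed
  have "smooth_on S (\<lambda>y. f y \<bullet> b)"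
    using assms by (intro smooth_on_inner smooth_on_const)
  from mixed_derivatives_commute_real[OF assms(1) this assms(3), of u v]
  show "frechet_derivative (\<lambda>y. frechet_derivative f (at y) u) (at x) v \<bullet> b
       = frechet_derivative (\<lambda>y. frechet_derivative f (at y) v) (at x) u \<bullet> b"
    by (simp add: 2)
qed

section \<open>Calculus on the unit sphere\<close>

lemma open_punctured: "open (- {0::'a::euclidean_space})"
  by auto

lemma sgn_on_sphere: "v \<in> sphere 0 1 \<Longrightarrow> sgn v = (v :: 'a::real_normed_vector)"
  by (simp add: sgn_div_norm)

lemma sgn_in_sphere: "w \<noteq> 0 \<Longrightarrow> sgn w \<in> sphere 0 (1::real)" for w :: "'a::real_normed_vector"
  by (simp add: norm_sgn)

lemma sphere_nonzero: "v \<in> sphere 0 1 \<Longrightarrow> v \<in> - {0::'a::real_normed_vector}"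
  by auto

lemma sgn_has_derivative:
  fixes v :: "'a::real_inner"
  assumes "v \<in> sphere 0 1"
  shows "(sgn has_derivative (\<lambda>u. u - (u \<bullet> v) *\<^sub>R v)) (at v)"
proof -
  have nv: "norm v = 1" "v \<noteq> 0" using assms by auto
  have "((\<lambda>w. inverse (norm w) *\<^sub>R w) has_derivative (\<lambda>u. u - (u \<bullet> v) *\<^sub>R v)) (at v)"
    using nv by (auto intro!: derivative_eq_intros has_derivative_norm simp: sgn_div_norm fun_eq_iff)
  then show ?thesis by (simp add: sgn_div_norm[abs_def])
qed

lemma smooth_on_sphere_has_derivative:
  "smooth_on_sphere f \<Longrightarrow> v \<in> sphere 0 1 \<Longrightarrow>
   ((\<lambda>w. f (sgn w)) has_derivative frechet_derivative (\<lambda>w. f (sgn w)) (at v)) (at v)"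
  unfolding smooth_on_sphere_def by (rule smooth_on_has_derivative) (auto dest: sphere_nonzero)

lemma deriv_along_eqI:
  "((\<lambda>w. f (sgn w)) has_derivative D) (at v) \<Longrightarrow> deriv_along X f v = D (X v)"
  unfolding deriv_along_def using frechet_derivative_at by metis

lemma smooth_on_sphere_cong:
  "smooth_on_sphere f \<Longrightarrow> (\<And>v. v \<in> sphere 0 1 \<Longrightarrow> f v = g v) \<Longrightarrow> smooth_on_sphere g"
  unfolding smooth_on_sphere_def
  by (erule smooth_on_cong[OF open_punctured]) (auto intro!: simp: norm_sgn)

lemma deriv_along_cong:
  assumes "smooth_on_sphere f" "\<And>v. v \<in> sphere 0 1 \<Longrightarrow> f v = g v" "v \<in> sphere 0 1"
  shows "deriv_along X f v = deriv_along X g v"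
proof -
  have "((\<lambda>w. g (sgn w)) has_derivative frechet_derivative (\<lambda>w. f (sgn w)) (at v)) (at v)"
    by (rule has_derivative_transform_within_open[OF smooth_on_sphere_has_derivative[OF assms(1,3)] open_punctured sphere_nonzero[OF assms(3)]])
      (auto simp: norm_sgn assms(2))
  from deriv_along_eqI[OF this] show ?thesis by (simp add: deriv_along_def)
qed

lemma smooth_on_sphere_const: "smooth_on_sphere (\<lambda>v. c)"
  and smooth_on_sphere_ident: "smooth_on_sphere (\<lambda>v. v)"
  and smooth_on_sphere_add: "smooth_on_sphere f \<Longrightarrow> smooth_on_sphere g \<Longrightarrow> smooth_on_sphere (\<lambda>v. f v + g v)"
  and smooth_on_sphere_diff: "smooth_on_sphere f \<Longrightarrow> smooth_on_sphere g \<Longrightarrow> smooth_on_sphere (\<lambda>v. f v - g v)"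
  and smooth_on_sphere_scaleR: "smooth_on_sphere r \<Longrightarrow> smooth_on_sphere f \<Longrightarrow> smooth_on_sphere (\<lambda>v. r v *\<^sub>R f v)"
  by (simp_all add: smooth_on_sphere_def smooth_on_const smooth_on_sgn smooth_on_add smooth_on_diff
      smooth_on_scaleR open_punctured)

lemma smooth_on_sphere_linear:
  "bounded_linear L \<Longrightarrow> smooth_on_sphere f \<Longrightarrow> smooth_on_sphere (\<lambda>v. L (f v))"
  unfolding smooth_on_sphere_def by (rule smooth_on_bounded_linear[OF open_punctured])

lemma smooth_on_sphere_mult:
  fixes f g :: "'a::euclidean_space \<Rightarrow> real"
  shows "smooth_on_sphere f \<Longrightarrow> smooth_on_sphere g \<Longrightarrow> smooth_on_sphere (\<lambda>v. f v * g v)"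
  by (simp add: smooth_on_sphere_def smooth_on_mult open_punctured)

lemma smooth_on_sphere_inner:
  "smooth_on_sphere f \<Longrightarrow> smooth_on_sphere g \<Longrightarrow> smooth_on_sphere (\<lambda>v. f v \<bullet> g v)"
  by (simp add: smooth_on_sphere_def smooth_on_inner open_punctured)

text \<open>A function of \<open>sgn w\<close> is constant along rays, so its derivative is homogeneous of degree \<open>-1\<close>.
This moves the evaluation point from \<open>sgn w\<close> to \<open>w\<close>, where smoothness on the punctured space applies.\<close>

lemma frechet_derivative_radial:
  fixes f :: "'a::euclidean_space \<Rightarrow> 'b::real_normed_vector"
  assumes "smooth_on_sphere f" "w \<noteq> 0"
  shows "frechet_derivative (\<lambda>w. f (sgn w)) (at (sgn w)) u
       = norm w *\<^sub>R frechet_derivative (\<lambda>w. f (sgn w)) (at w) u"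
proof -
  let ?F = "\<lambda>w. f (sgn w)" and ?c = "inverse (norm w)"
  have sw: "sgn w = ?c *\<^sub>R w" by (simp add: sgn_div_norm)
  have hd: "(?F has_derivative frechet_derivative ?F (at p)) (at p)" if "p \<noteq> 0" for p
    using assms(1) smooth_on_has_derivative[of "- {0}" ?F p] that by (simp add: smooth_on_sphere_def)
  have "sgn w \<noteq> 0" using assms(2) by (simp add: sgn_zero_iff)
  then have 1: "(?F has_derivative frechet_derivative ?F (at (sgn w))) (at (?c *\<^sub>R w))"
    using hd[of "sgn w"] by (simp add: sw)
  have 2: "((\<lambda>p. ?c *\<^sub>R p) has_derivative (\<lambda>u. ?c *\<^sub>R u)) (at w)"
    by (auto intro!: derivative_eq_intros)
  have "(\<lambda>p. ?F (?c *\<^sub>R p)) = ?F"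
    using assms(2) by (simp add: sgn_scaleR)
  then have "(?F has_derivative (\<lambda>u. frechet_derivative ?F (at (sgn w)) (?c *\<^sub>R u))) (at w)"
    using diff_chain_at[OF 2 1] by (simp add: o_def)
  from frechet_derivative_at[OF this]
  have "frechet_derivative ?F (at w) u = frechet_derivative ?F (at (sgn w)) (?c *\<^sub>R u)"
    by (simp add: fun_eq_iff)
  also have "\<dots> = ?c *\<^sub>R frechet_derivative ?F (at (sgn w)) u"
    using 1 by (simp add: linear_cmul has_derivative_linear)
  finally show ?thesis using assms(2) by simp
qed

lemma smooth_on_sphere_deriv_along:
  fixes f :: "'a::euclidean_space \<Rightarrow> 'b::real_normed_vector"
  assumes "smooth_on_sphere X" "smooth_on_sphere f"
  shows "smooth_on_sphere (deriv_along X f)"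
  unfolding smooth_on_sphere_def deriv_along_def
proof (rule smooth_on_cong[OF open_punctured])
  show "smooth_on (- {0::'a}) (\<lambda>w. norm w *\<^sub>R frechet_derivative (\<lambda>w. f (sgn w)) (at w) (X (sgn w)))"
    using assms unfolding smooth_on_sphere_def
    by (intro smooth_on_scaleR smooth_on_norm smooth_on_frechet_derivative_along open_punctured)
qed (simp add: frechet_derivative_radial assms)

lemma deriv_along_linear:
  assumes "smooth_on_sphere f" "v \<in> sphere 0 1"
  shows "deriv_along (\<lambda>w. X w + Y w) f v = deriv_along X f v + deriv_along Y f v"
    and "deriv_along (\<lambda>w. r w *\<^sub>R X w) f v = r v *\<^sub>R deriv_along X f v"
  using has_derivative_linear[OF smooth_on_sphere_has_derivative[OF assms]]
  by (simp_all add: deriv_along_def linear_add linear_cmul)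

lemma deriv_along_add:
  assumes "smooth_on_sphere f" "smooth_on_sphere g" "v \<in> sphere 0 1"
  shows "deriv_along X (\<lambda>w. f w + g w) v = deriv_along X f v + deriv_along X g v"
  by (rule deriv_along_eqI[OF has_derivative_eq_rhs[OF
        has_derivative_add[OF smooth_on_sphere_has_derivative[OF assms(1,3)]
          smooth_on_sphere_has_derivative[OF assms(2,3)]]], THEN trans])
     (auto simp: deriv_along_def)

lemma deriv_along_scaleR:
  assumes "smooth_on_sphere r" "smooth_on_sphere f" "v \<in> sphere 0 1"
  shows "deriv_along X (\<lambda>w. r w *\<^sub>R f w) v = deriv_along X r v *\<^sub>R f v + r v *\<^sub>R deriv_along X f v"
  by (rule deriv_along_eqI[OF has_derivative_eq_rhs[OF
        has_derivative_scaleR[OF smooth_on_sphere_has_derivative[OF assms(1,3)]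
          smooth_on_sphere_has_derivative[OF assms(2,3)]]], THEN trans])
     (auto simp: deriv_along_def sgn_on_sphere[OF assms(3)])

lemma deriv_along_inner:
  assumes "smooth_on_sphere f" "smooth_on_sphere g" "v \<in> sphere 0 1"
  shows "deriv_along X (\<lambda>w. f w \<bullet> g w) v = deriv_along X f v \<bullet> g v + f v \<bullet> deriv_along X g v"
  by (rule deriv_along_eqI[OF has_derivative_eq_rhs[OF
        has_derivative_inner[OF smooth_on_sphere_has_derivative[OF assms(1,3)]
          smooth_on_sphere_has_derivative[OF assms(2,3)]]], THEN trans])
     (auto simp: deriv_along_def sgn_on_sphere[OF assms(3)])

lemma vector_fieldD:
  assumes "vector_field X"
  shows "smooth_on_sphere X" "v \<in> sphere 0 1 \<Longrightarrow> X v \<bullet> v = 0"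
  using assms by (auto simp: vector_field_def)

lemma deriv_along_ident:
  assumes "v \<in> sphere 0 1" "X v \<bullet> v = 0"
  shows "deriv_along X (\<lambda>w. w) v = X v"
  using deriv_along_eqI[OF sgn_has_derivative[OF assms(1)], of "X"] assms(2) by simp

text \<open>Differentiating \<open>\<langle>Y, v\<rangle> = 0\<close> along \<open>X\<close>: the derivative of a field has a normal component, which the
round connection removes by adding \<open>\<langle>X, Y\<rangle> v\<close>.\<close>

lemma deriv_along_normal:
  assumes X: "vector_field X" and Y: "vector_field Y" and v: "v \<in> sphere 0 1"
  shows "deriv_along X Y v \<bullet> v = - (X v \<bullet> Y v)"
proof -
  have "deriv_along X (\<lambda>w. Y w \<bullet> w) v = deriv_along X (\<lambda>w. 0) v"
    by (rule deriv_along_cong[OF _ _ v])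
      (use vector_fieldD[OF Y] in \<open>auto intro!: smooth_on_sphere_inner smooth_on_sphere_ident\<close>)
  also have "\<dots> = 0" by (simp add: deriv_along_def)
  finally show ?thesis
    using deriv_along_inner[OF vector_fieldD(1)[OF Y] smooth_on_sphere_ident v, of X]
      deriv_along_ident[of v X, OF v vector_fieldD(2)[OF X v]] by (simp add: inner_commute)
qed

lemma vector_field_diff: "vector_field X \<Longrightarrow> vector_field Y \<Longrightarrow> vector_field (\<lambda>v. X v - Y v)"
  by (auto simp: vector_field_def smooth_on_sphere_diff inner_diff_left)

lemma vector_field_lie_bracket:
  assumes "vector_field X" "vector_field Y"
  shows "vector_field (lie_bracket X Y)"
  unfolding vector_field_def lie_bracket_def
proof (intro conjI ballI)
  show "smooth_on_sphere (\<lambda>v. deriv_along X Y v - deriv_along Y X v)"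
    by (intro smooth_on_sphere_diff smooth_on_sphere_deriv_along vector_fieldD(1) assms)
  show "(deriv_along X Y v - deriv_along Y X v) \<bullet> v = 0" if "v \<in> sphere 0 1" for v
    using deriv_along_normal[OF assms that] deriv_along_normal[OF assms(2,1) that]
    by (simp add: inner_diff_left inner_commute[of "X v" "Y v"])
qed

text \<open>The tangential part of a constant field takes a prescribed tangent value, so
statements about fields translate into statements about tangent vectors at one point.\<close>

lemma vector_field_through:
  fixes x v :: "'a::euclidean_space"
  assumes "v \<in> sphere 0 1" "x \<bullet> v = 0"
  obtains X where "vector_field X" "X v = x"
proof
  show "vector_field (\<lambda>w. x - (x \<bullet> w) *\<^sub>R w)"
    by (auto simp: vector_field_def inner_diff_left dot_square_norm intro!: smooth_on_sphere_diff
        smooth_on_sphere_scaleR smooth_on_sphere_inner smooth_on_sphere_const smooth_on_sphere_ident)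
  show "x - (x \<bullet> v) *\<^sub>R v = x" using assms by simp
qed

lemma is_levi_civitaD:
  assumes "is_levi_civita g D" "vector_field X" "vector_field Y"
  shows "vector_field (D X Y)"
    and "v \<in> sphere 0 1 \<Longrightarrow> D X Y v - D Y X v = lie_bracket X Y v"
    and "vector_field Z \<Longrightarrow> v \<in> sphere 0 1 \<Longrightarrow>
      deriv_along X (\<lambda>w. g w (Y w) (Z w)) v = g v (D X Y v) (Z v) + g v (Y v) (D X Z v)"
proof -
  note LC = assms(1)[unfolded is_levi_civita_def]
  show "vector_field (D X Y)"
    using LC[THEN conjunct1, unfolded affine_connection_def, THEN conjunct1] assms(2,3) by simp
  show "D X Y v - D Y X v = lie_bracket X Y v" if "v \<in> sphere 0 1"
    using LC[THEN conjunct2, THEN conjunct1, rule_format, OF assms(2,3) that] .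
  show "deriv_along X (\<lambda>w. g w (Y w) (Z w)) v = g v (D X Y v) (Z v) + g v (Y v) (D X Z v)"
    if "vector_field Z" "v \<in> sphere 0 1"
    using LC[THEN conjunct2, THEN conjunct2, rule_format, OF assms(2,3) that] .
qed

text \<open>The difference \<open>T\<close> of two Levi-Civita connections is symmetric, and \<open>g(T(U, W), Z)\<close> is skew in \<open>W\<close>
and \<open>Z\<close>; a trilinear expression with both symmetries vanishes. Testing against the field
\<open>Z = T(X, Y)\<close> itself gives the result without first proving that \<open>T\<close> is a tensor.\<close>

lemma levi_civita_unique:
  assumes D: "is_levi_civita g D" and D': "is_levi_civita g D'"
    and g: "\<And>v x. v \<in> sphere 0 1 \<Longrightarrow> x \<bullet> v = 0 \<Longrightarrow> x \<noteq> 0 \<Longrightarrow> g v x x > 0"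
    "\<And>v. v \<in> sphere 0 1 \<Longrightarrow> bilinear (g v)" "\<And>v x y. v \<in> sphere 0 1 \<Longrightarrow> g v x y = g v y x"
    and XY: "vector_field X" "vector_field Y" and v: "v \<in> sphere 0 1"
  shows "D X Y v = D' X Y v"
proof -
  define T where "T U W = D U W v - D' U W v" for U W
  note LC = is_levi_civitaD[OF D] is_levi_civitaD[OF D']
  have sym: "T U W = T W U" if "vector_field U" "vector_field W" for U W
    using LC(2)[OF that v] LC(5)[OF that v] by (simp add: T_def algebra_simps)
  have skew: "g v (T U W) (Z v) = - g v (T U Z) (W v)"
    if "vector_field U" "vector_field W" "vector_field Z" for U W Z
    using LC(3)[OF that v] LC(6)[OF that v] g(3)[OF v]
    by (simp add: T_def bilinear_lsub[OF g(2)[OF v]] bilinear_rsub[OF g(2)[OF v]])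
  have T0: "g v (T U W) (Z v) = 0" if UWZ: "vector_field U" "vector_field W" "vector_field Z" for U W Z
    using skew[OF UWZ] skew[OF UWZ(3,1,2)] skew[OF UWZ(2,3,1)]
    unfolding sym[OF UWZ(1,3)] sym[OF UWZ(2,3)] sym[OF UWZ(1,2)] by linarith
  have "vector_field (\<lambda>v. D X Y v - D' X Y v)"
    using LC(1,4) XY by (intro vector_field_diff)
  from T0[OF XY this] vector_fieldD(2)[OF this v]
  have "g v (T X Y) (T X Y) = 0" "T X Y \<bullet> v = 0" by (simp_all add: T_def)
  then have "T X Y = 0" using g(1)[OF v, of "T X Y"] by fastforce
  then show ?thesis by (simp add: T_def)
qed

section \<open>Algebra of the three fiber fields\<close>

text \<open>Right multiplication reverses the order of products, hence \<open>X1 (X2 x) = - X3 x\<close> and not \<open>X3 x\<close>.\<close>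

lemma fiber_field_compose:
  fixes x :: "quat ^ ('m::finite)"
  shows "X1 (X1 x) = - x" "X2 (X2 x) = - x" "X3 (X3 x) = - x"
    "X1 (X2 x) = - X3 x" "X2 (X1 x) = X3 x"
    "X2 (X3 x) = - X1 x" "X3 (X2 x) = X1 x"
    "X3 (X1 x) = - X2 x" "X1 (X3 x) = X2 x"
  by (auto simp: fiber_field_def right_mult_def vec_eq_iff qmult_def qi_def qj_def qk_def prod_eq_iff
      split: prod.splits)

lemma fiber_field_skew:
  fixes x y :: "quat ^ ('m::finite)"
  shows "X1 x \<bullet> y = - (x \<bullet> X1 y)" "X2 x \<bullet> y = - (x \<bullet> X2 y)" "X3 x \<bullet> y = - (x \<bullet> X3 y)"
  by (auto simp: fiber_field_def right_mult_def inner_vec_def qmult_def qi_def qj_def qk_def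
      inner_prod_def algebra_simps sum_negf[symmetric] split: prod.splits intro!: sum.cong)

lemma linear_fiber_field: "linear (fiber_field q :: quat ^ ('m::finite) \<Rightarrow> _)"
  by (auto intro!: linearI simp: fiber_field_def right_mult_def vec_eq_iff qmult_def prod_eq_iff
      algebra_simps split: prod.splits)

lemma bounded_linear_fiber_field: "bounded_linear (fiber_field q :: quat ^ ('m::finite) \<Rightarrow> _)"
  using linear_conv_bounded_linear linear_fiber_field by blast

lemmas fiber_field_linear =
  linear_add[OF linear_fiber_field] linear_diff[OF linear_fiber_field]
  linear_cmul[OF linear_fiber_field] linear_neg[OF linear_fiber_field]
  linear_0[OF linear_fiber_field]

lemma inner_fiber_field_self:
  fixes x :: "quat ^ ('m::finite)"
  shows "x \<bullet> X1 x = 0" "x \<bullet> X2 x = 0" "x \<bullet> X3 x = 0"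
  using fiber_field_tangent[of x] by (simp_all add: inner_commute)

lemma hopf_metric_eq:
  fixes v :: "quat ^ ('m::finite)"
  assumes "v \<in> sphere 0 1"
  shows "hopf_metric t1 t2 t3 v x y = x \<bullet> y + (t1 - 1) * (x \<bullet> X1 v) * (y \<bullet> X1 v)
     + (t2 - 1) * (x \<bullet> X2 v) * (y \<bullet> X2 v) + (t3 - 1) * (x \<bullet> X3 v) * (y \<bullet> X3 v)"
proof -
  note o = fiber_field_unit[OF assms] fiber_field_orthogonal[of v]
    fiber_field_orthogonal[of v, unfolded inner_commute[of "X1 v"] inner_commute[of "X2 v" "X3 v"]]
  show ?thesis
    by (simp add: hopf_metric_def horizontal_part_def o inner_diff_left inner_diff_right
        inner_commute[of _ y] algebra_simps)
qed

text \<open>The coefficient, in the \<open>X_i\<close>-component of the connection, that comes from inverting the metric on the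
fiber. Naming it keeps denominators out of the polynomial identities for the curvature.\<close>

definition fiber_coeff :: "real \<Rightarrow> real \<Rightarrow> real \<Rightarrow> real" where
  "fiber_coeff ti tj tk = (1 / ti - 1) * (tk - tj)"

text \<open>The tensor \<open>S\<close> by which the Levi-Civita connection of the metric exceeds that of the round metric,
obtained by solving the Koszul formula; \<open>hopf_metric_christoffel\<close> is the equation it solves. The
coefficients \<open>fiber_coeff\<close> arise from inverting the metric on the fiber, and the multiple of \<open>v\<close>
makes \<open>S\<close> tangential. The expression is written as a polynomial in \<open>v\<close>, so that it can be
differentiated in the base point.\<close>

definition christoffel ::
    "real \<Rightarrow> real \<Rightarrow> real \<Rightarrow> quat ^ 'm \<Rightarrow> quat ^ 'm \<Rightarrow> quat ^ 'm \<Rightarrow> quat ^ ('m::finite)" where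
  "christoffel t1 t2 t3 v x y =
     (t1 - 1) *\<^sub>R ((y \<bullet> X1 v) *\<^sub>R X1 x + (x \<bullet> X1 v) *\<^sub>R X1 y)
   + (t2 - 1) *\<^sub>R ((y \<bullet> X2 v) *\<^sub>R X2 x + (x \<bullet> X2 v) *\<^sub>R X2 y)
   + (t3 - 1) *\<^sub>R ((y \<bullet> X3 v) *\<^sub>R X3 x + (x \<bullet> X3 v) *\<^sub>R X3 y)
   + (2 * ((t1 - 1) * ((x \<bullet> X1 v) * (y \<bullet> X1 v)) + (t2 - 1) * ((x \<bullet> X2 v) * (y \<bullet> X2 v))
         + (t3 - 1) * ((x \<bullet> X3 v) * (y \<bullet> X3 v)))) *\<^sub>R v
   + (fiber_coeff t1 t2 t3 * ((x \<bullet> X2 v) * (y \<bullet> X3 v) + (x \<bullet> X3 v) * (y \<bullet> X2 v))) *\<^sub>R X1 v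
   + (fiber_coeff t2 t3 t1 * ((x \<bullet> X3 v) * (y \<bullet> X1 v) + (x \<bullet> X1 v) * (y \<bullet> X3 v))) *\<^sub>R X2 v
   + (fiber_coeff t3 t1 t2 * ((x \<bullet> X1 v) * (y \<bullet> X2 v) + (x \<bullet> X2 v) * (y \<bullet> X1 v))) *\<^sub>R X3 v"

lemma christoffel_sym: "christoffel t1 t2 t3 v x y = christoffel t1 t2 t3 v y x"
  by (simp add: christoffel_def add.commute mult.commute)

lemma christoffel_linear:
  "christoffel t1 t2 t3 v (x + x') y = christoffel t1 t2 t3 v x y + christoffel t1 t2 t3 v x' y"
  "christoffel t1 t2 t3 v (c *\<^sub>R x) y = c *\<^sub>R christoffel t1 t2 t3 v x y"
  by (simp_all add: christoffel_def fiber_field_linear inner_add_left algebra_simps)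

lemma christoffel_diff: "christoffel t1 t2 t3 v (x - x') y = christoffel t1 t2 t3 v x y - christoffel t1 t2 t3 v x' y"
  using christoffel_linear(1)[of t1 t2 t3 v "x - x'" x' y] by simp

lemmas inner_expand = inner_add_left inner_add_right inner_diff_left inner_diff_right
  inner_scaleR_left inner_scaleR_right inner_minus_left inner_minus_right

lemma christoffel_tangent:
  assumes "v \<in> sphere 0 1" "x \<bullet> v = 0" "y \<bullet> v = 0"
  shows "christoffel t1 t2 t3 v x y \<bullet> v = 0"
proof -
  have "v \<bullet> v = 1" using assms(1) by (simp add: dot_square_norm)
  then show ?thesis
    by (simp add: christoffel_def inner_expand fiber_field_skew inner_fiber_field_self algebra_simps)
qed

lemma inner_christoffel_fiber_field:
  fixes v :: "quat ^ ('m::finite)"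
  assumes v: "v \<in> sphere 0 1" and x: "x \<bullet> v = 0" and y: "y \<bullet> v = 0"
  shows "christoffel t1 t2 t3 v x y \<bullet> X1 v
    = (fiber_coeff t1 t2 t3 + (t3 - t2)) * ((x \<bullet> X2 v) * (y \<bullet> X3 v) + (x \<bullet> X3 v) * (y \<bullet> X2 v))" (is ?T1)
    and "christoffel t1 t2 t3 v x y \<bullet> X2 v
    = (fiber_coeff t2 t3 t1 + (t1 - t3)) * ((x \<bullet> X3 v) * (y \<bullet> X1 v) + (x \<bullet> X1 v) * (y \<bullet> X3 v))" (is ?T2)
    and "christoffel t1 t2 t3 v x y \<bullet> X3 v
    = (fiber_coeff t3 t1 t2 + (t2 - t1)) * ((x \<bullet> X1 v) * (y \<bullet> X2 v) + (x \<bullet> X2 v) * (y \<bullet> X1 v))" (is ?T3)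
proof -
  have vv: "v \<bullet> v = 1" using v by (simp add: dot_square_norm)
  show ?T1 ?T2 ?T3
    by (simp_all add: christoffel_def inner_expand fiber_field_skew fiber_field_compose inner_fiber_field_self
      x y vv algebra_simps)
qed

text \<open>By the Koszul formula \<open>2 g(S(x, y), z)\<close> is the cyclic combination of the covariant derivatives of
\<open>g\<close>. Since \<open>\<nabla>\<theta>_r\<close> is skew, two of the six terms for each \<open>r\<close> cancel and the others pair up, which
leaves the right-hand side.\<close>

lemma hopf_metric_christoffel:
  fixes v :: "quat ^ ('m::finite)"
  assumes v: "v \<in> sphere 0 1" and z: "z \<bullet> v = 0" and x: "x \<bullet> v = 0" and y: "y \<bullet> v = 0"
    and t: "t1 > 0" "t2 > 0" "t3 > 0"
  shows "hopf_metric t1 t2 t3 v (christoffel t1 t2 t3 v x y) z =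
     (t1 - 1) * ((y \<bullet> X1 v) * (X1 x \<bullet> z) + (x \<bullet> X1 v) * (X1 y \<bullet> z))
   + (t2 - 1) * ((y \<bullet> X2 v) * (X2 x \<bullet> z) + (x \<bullet> X2 v) * (X2 y \<bullet> z))
   + (t3 - 1) * ((y \<bullet> X3 v) * (X3 x \<bullet> z) + (x \<bullet> X3 v) * (X3 y \<bullet> z))"
proof -
  show ?thesis
    unfolding hopf_metric_eq[OF v] inner_christoffel_fiber_field[OF v x y]
    using t by (simp add: christoffel_def inner_expand inner_commute[of _ z] z)
      (simp add: fiber_coeff_def field_simps)
qed

text \<open>The derivative of \<open>christoffel\<close> in the base point \<open>v\<close> in direction \<open>u\<close>, with \<open>x\<close> and \<open>y\<close> held fixed.\<close>

definition dchristoffel ::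
    "real \<Rightarrow> real \<Rightarrow> real \<Rightarrow> quat ^ 'm \<Rightarrow> quat ^ 'm \<Rightarrow> quat ^ 'm \<Rightarrow> quat ^ 'm \<Rightarrow> quat ^ ('m::finite)" where
  "dchristoffel t1 t2 t3 v u x y =
     (t1 - 1) *\<^sub>R ((y \<bullet> X1 u) *\<^sub>R X1 x + (x \<bullet> X1 u) *\<^sub>R X1 y)
   + (t2 - 1) *\<^sub>R ((y \<bullet> X2 u) *\<^sub>R X2 x + (x \<bullet> X2 u) *\<^sub>R X2 y)
   + (t3 - 1) *\<^sub>R ((y \<bullet> X3 u) *\<^sub>R X3 x + (x \<bullet> X3 u) *\<^sub>R X3 y)
   + (2 * ((t1 - 1) * ((x \<bullet> X1 u) * (y \<bullet> X1 v) + (x \<bullet> X1 v) * (y \<bullet> X1 u))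
         + (t2 - 1) * ((x \<bullet> X2 u) * (y \<bullet> X2 v) + (x \<bullet> X2 v) * (y \<bullet> X2 u))
         + (t3 - 1) * ((x \<bullet> X3 u) * (y \<bullet> X3 v) + (x \<bullet> X3 v) * (y \<bullet> X3 u)))) *\<^sub>R v
   + (2 * ((t1 - 1) * ((x \<bullet> X1 v) * (y \<bullet> X1 v)) + (t2 - 1) * ((x \<bullet> X2 v) * (y \<bullet> X2 v))
         + (t3 - 1) * ((x \<bullet> X3 v) * (y \<bullet> X3 v)))) *\<^sub>R u
   + (fiber_coeff t1 t2 t3 * ((x \<bullet> X2 u) * (y \<bullet> X3 v) + (x \<bullet> X2 v) * (y \<bullet> X3 u)
         + (x \<bullet> X3 u) * (y \<bullet> X2 v) + (x \<bullet> X3 v) * (y \<bullet> X2 u))) *\<^sub>R X1 v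
   + (fiber_coeff t2 t3 t1 * ((x \<bullet> X3 u) * (y \<bullet> X1 v) + (x \<bullet> X3 v) * (y \<bullet> X1 u)
         + (x \<bullet> X1 u) * (y \<bullet> X3 v) + (x \<bullet> X1 v) * (y \<bullet> X3 u))) *\<^sub>R X2 v
   + (fiber_coeff t3 t1 t2 * ((x \<bullet> X1 u) * (y \<bullet> X2 v) + (x \<bullet> X1 v) * (y \<bullet> X2 u)
         + (x \<bullet> X2 u) * (y \<bullet> X1 v) + (x \<bullet> X2 v) * (y \<bullet> X1 u))) *\<^sub>R X3 v
   + (fiber_coeff t1 t2 t3 * ((x \<bullet> X2 v) * (y \<bullet> X3 v) + (x \<bullet> X3 v) * (y \<bullet> X2 v))) *\<^sub>R X1 u
   + (fiber_coeff t2 t3 t1 * ((x \<bullet> X3 v) * (y \<bullet> X1 v) + (x \<bullet> X1 v) * (y \<bullet> X3 v))) *\<^sub>R X2 u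
   + (fiber_coeff t3 t1 t2 * ((x \<bullet> X1 v) * (y \<bullet> X2 v) + (x \<bullet> X2 v) * (y \<bullet> X1 v))) *\<^sub>R X3 u"

lemma christoffel_has_derivative:
  fixes V Y Z :: "'a::real_normed_vector \<Rightarrow> quat ^ ('m::finite)"
  assumes "(V has_derivative V') (at w)" "(Y has_derivative Y') (at w)" "(Z has_derivative Z') (at w)"
  shows "((\<lambda>w. christoffel t1 t2 t3 (V w) (Y w) (Z w)) has_derivative
     (\<lambda>u. dchristoffel t1 t2 t3 (V w) (V' u) (Y w) (Z w) + christoffel t1 t2 t3 (V w) (Y' u) (Z w)
        + christoffel t1 t2 t3 (V w) (Y w) (Z' u))) (at w)"
  unfolding christoffel_def dchristoffel_def
  by (rule has_derivative_eq_rhs,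
      (rule derivative_intros assms bounded_linear.has_derivative[OF bounded_linear_fiber_field])+,
      rule ext, simp add: scaleR_add_left scaleR_add_right distrib_left distrib_right)

section \<open>The Levi-Civita connection of the metric\<close>

lemma hopf_metric_bilinear: "bilinear (hopf_metric t1 t2 t3 v)"
  by (auto simp: bilinear_def hopf_metric_def horizontal_part_def inner_expand algebra_simps
      intro!: linearI)

lemma hopf_metric_sym: "hopf_metric t1 t2 t3 v x y = hopf_metric t1 t2 t3 v y x"
  by (simp add: hopf_metric_def inner_commute mult.commute)

lemma hopf_metric_pos:
  assumes "t1 > 0" "t2 > 0" "t3 > 0" "x \<noteq> 0"
  shows "hopf_metric t1 t2 t3 v x x > 0"
proof (cases "horizontal_part v x = 0")
  case True
  then have "x \<bullet> X1 v \<noteq> 0 \<or> x \<bullet> X2 v \<noteq> 0 \<or> x \<bullet> X3 v \<noteq> 0"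
    using assms(4) by (auto simp: horizontal_part_def)
  then have "(x \<bullet> X1 v)\<^sup>2 > 0 \<or> (x \<bullet> X2 v)\<^sup>2 > 0 \<or> (x \<bullet> X3 v)\<^sup>2 > 0"
    by simp
  then have "t1 * (x \<bullet> X1 v)\<^sup>2 > 0 \<or> t2 * (x \<bullet> X2 v)\<^sup>2 > 0 \<or> t3 * (x \<bullet> X3 v)\<^sup>2 > 0"
    using assms by (simp add: zero_less_mult_iff)
  moreover have "t1 * (x \<bullet> X1 v)\<^sup>2 \<ge> 0" "t2 * (x \<bullet> X2 v)\<^sup>2 \<ge> 0" "t3 * (x \<bullet> X3 v)\<^sup>2 \<ge> 0"
    using assms by simp_all
  ultimately have "t1 * (x \<bullet> X1 v)\<^sup>2 + t2 * (x \<bullet> X2 v)\<^sup>2 + t3 * (x \<bullet> X3 v)\<^sup>2 > 0"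
    by linarith
  then show ?thesis
    by (simp add: hopf_metric_def True power2_eq_square mult.assoc)
next
  case False
  have "t1 * ((x \<bullet> X1 v) * (x \<bullet> X1 v)) \<ge> 0" "t2 * ((x \<bullet> X2 v) * (x \<bullet> X2 v)) \<ge> 0"
    "t3 * ((x \<bullet> X3 v) * (x \<bullet> X3 v)) \<ge> 0"
    using assms by simp_all
  then show ?thesis
    using False by (simp add: hopf_metric_def mult.assoc add_pos_nonneg)
qed

definition hopf_connection ::
    "real \<Rightarrow> real \<Rightarrow> real \<Rightarrow> (quat ^ ('m::finite)) connection" where
  "hopf_connection t1 t2 t3 X Y v =
     deriv_along X Y v + (X v \<bullet> Y v) *\<^sub>R v + christoffel t1 t2 t3 v (X v) (Y v)"

lemma smooth_on_sphere_christoffel: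
  assumes "smooth_on_sphere X" "smooth_on_sphere Y"
  shows "smooth_on_sphere (\<lambda>v. christoffel t1 t2 t3 v (X v) (Y v))"
  unfolding christoffel_def
  by (intro smooth_on_sphere_add smooth_on_sphere_scaleR smooth_on_sphere_inner smooth_on_sphere_const
      smooth_on_sphere_ident smooth_on_sphere_mult smooth_on_sphere_linear[OF bounded_linear_fiber_field] assms)

lemma vector_field_hopf_connection:
  fixes X Y :: "quat ^ 'm \<Rightarrow> quat ^ ('m::finite)"
  assumes X: "vector_field X" and Y: "vector_field Y"
  shows "vector_field (hopf_connection t1 t2 t3 X Y)"
  unfolding vector_field_def
proof (intro conjI ballI)
  show "smooth_on_sphere (hopf_connection t1 t2 t3 X Y)"
    unfolding hopf_connection_def[abs_def]
    by (intro smooth_on_sphere_add smooth_on_sphere_scaleR smooth_on_sphere_inner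
      smooth_on_sphere_ident smooth_on_sphere_deriv_along smooth_on_sphere_christoffel
      X[THEN vector_fieldD(1)] Y[THEN vector_fieldD(1)])
  fix v :: "quat ^ 'm" assume v: "v \<in> sphere 0 1"
  then have "v \<bullet> v = 1" by (simp add: dot_square_norm)
  then show "hopf_connection t1 t2 t3 X Y v \<bullet> v = 0"
    using deriv_along_normal[OF X Y v] christoffel_tangent[OF v vector_fieldD(2)[OF X v] vector_fieldD(2)[OF Y v]]
    by (simp add: hopf_connection_def inner_add_left)
qed

lemma christoffel_linear_right:
  "christoffel t1 t2 t3 v x (y + y') = christoffel t1 t2 t3 v x y + christoffel t1 t2 t3 v x y'"
  "christoffel t1 t2 t3 v x (c *\<^sub>R y) = c *\<^sub>R christoffel t1 t2 t3 v x y"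
  using christoffel_linear[of t1 t2 t3 v] by (simp_all add: christoffel_sym[of t1 t2 t3 v x])

lemma affine_connection_hopf: "affine_connection (hopf_connection t1 t2 t3)"
  unfolding affine_connection_def
proof (intro conjI allI impI ballI)
  fix X Y Z :: "quat ^ 'm \<Rightarrow> quat ^ 'm" and f :: "quat ^ 'm \<Rightarrow> real" and v :: "quat ^ 'm"
  assume X: "vector_field X" and Y: "vector_field Y"
  show "vector_field (hopf_connection t1 t2 t3 X Y)"
    by (rule vector_field_hopf_connection[OF X Y])
  assume v: "v \<in> sphere 0 1"
  show "hopf_connection t1 t2 t3 (\<lambda>w. X w + Y w) Z v
      = hopf_connection t1 t2 t3 X Z v + hopf_connection t1 t2 t3 Y Z v"
    if Z: "vector_field Z"
    by (simp add: hopf_connection_def deriv_along_linear[OF vector_fieldD(1)[OF Z] v]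
      christoffel_linear inner_add_left algebra_simps)
  show "hopf_connection t1 t2 t3 Z (\<lambda>w. X w + Y w) v
      = hopf_connection t1 t2 t3 Z X v + hopf_connection t1 t2 t3 Z Y v"
    by (simp add: hopf_connection_def deriv_along_add[OF vector_fieldD(1)[OF X] vector_fieldD(1)[OF Y] v]
      christoffel_linear_right inner_add_right algebra_simps)
  show "hopf_connection t1 t2 t3 (\<lambda>w. f w *\<^sub>R X w) Y v = f v *\<^sub>R hopf_connection t1 t2 t3 X Y v"
    by (simp add: hopf_connection_def deriv_along_linear[OF vector_fieldD(1)[OF Y] v]
      christoffel_linear scaleR_add_right)
  show "hopf_connection t1 t2 t3 X (\<lambda>w. f w *\<^sub>R Y w) v
      = deriv_along X f v *\<^sub>R Y v + f v *\<^sub>R hopf_connection t1 t2 t3 X Y v"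
    if "smooth_on_sphere f"
    by (simp add: hopf_connection_def deriv_along_scaleR[OF that vector_fieldD(1)[OF Y] v]
      christoffel_linear_right scaleR_add_right)
qed

lemma deriv_along_fiber_field:
  fixes v :: "quat ^ ('m::finite)"
  assumes "v \<in> sphere 0 1" "X v \<bullet> v = 0"
  shows "deriv_along X (fiber_field q) v = fiber_field q (X v)"
  using deriv_along_eqI[OF bounded_linear.has_derivative[OF bounded_linear_fiber_field sgn_has_derivative[OF assms(1)]], of X q]
    assms(2) by simp

lemma deriv_along_scaleR_const:
  "smooth_on_sphere f \<Longrightarrow> v \<in> sphere 0 1 \<Longrightarrow> deriv_along X (\<lambda>w. (c::real) * f w) v = c * deriv_along X f v"
  using deriv_along_scaleR[of "\<lambda>w. c" f v X] smooth_on_sphere_const[of c]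
  by (simp add: deriv_along_def)

lemma deriv_along_mult:
  fixes f g :: "'a::euclidean_space \<Rightarrow> real"
  assumes "smooth_on_sphere f" "smooth_on_sphere g" "v \<in> sphere 0 1"
  shows "deriv_along X (\<lambda>w. f w * g w) v = deriv_along X f v * g v + f v * deriv_along X g v"
  using deriv_along_scaleR[OF assms] by simp

text \<open>The derivative of the metric coefficients produces the terms \<open>(t_r - 1) \<theta>_r \<langle>\<cdot>, X_r X\<rangle>\<close>. They are
matched by \<open>g(S(X, Y), Z) + g(Y, S(X, Z))\<close>, where the contributions containing \<open>\<langle>X_r Y, Z\<rangle>\<close> cancel by
skewness of \<open>X_r\<close>.\<close>

lemma hopf_connection_metric:
  fixes X Y Z :: "quat ^ 'm \<Rightarrow> quat ^ ('m::finite)"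
  assumes X: "vector_field X" and Y: "vector_field Y" and Z: "vector_field Z" and v: "v \<in> sphere 0 1"
    and t: "t1 > 0" "t2 > 0" "t3 > 0"
  shows "deriv_along X (\<lambda>w. hopf_metric t1 t2 t3 w (Y w) (Z w)) v
    = hopf_metric t1 t2 t3 v (hopf_connection t1 t2 t3 X Y v) (Z v)
    + hopf_metric t1 t2 t3 v (Y v) (hopf_connection t1 t2 t3 X Z v)"
proof -
  let ?g = "hopf_metric t1 t2 t3 v"
  note smooth = smooth_on_sphere_add smooth_on_sphere_inner smooth_on_sphere_const
      smooth_on_sphere_ident smooth_on_sphere_mult smooth_on_sphere_linear[OF bounded_linear_fiber_field]
      Y[THEN vector_fieldD(1)] Z[THEN vector_fieldD(1)]
  have fib: "smooth_on_sphere (fiber_field q :: quat ^ 'm \<Rightarrow> quat ^ 'm)" for q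
    using smooth_on_sphere_linear[OF bounded_linear_fiber_field smooth_on_sphere_ident] .
  have tang: "X v \<bullet> v = 0" "Y v \<bullet> v = 0" "Z v \<bullet> v = 0"
    using X Y Z v vector_fieldD(2) by blast+
  have vX: "v \<bullet> X1 v = 0" "v \<bullet> X2 v = 0" "v \<bullet> X3 v = 0"
    by (simp_all add: inner_fiber_field_self)
  \<comment> \<open>the metric does not see the normal component of the round connection\<close>
  have gv: "?g (c *\<^sub>R v) (Z v) = 0" "?g (Y v) (c *\<^sub>R v) = 0" for c
    using tang vX by (simp_all add: hopf_metric_eq[OF v] inner_commute[of v "Z v"])
  have Q: "deriv_along X (\<lambda>w. c * ((Y w \<bullet> fiber_field q w) * (Z w \<bullet> fiber_field q w))) v
      = c * ((deriv_along X Y v \<bullet> fiber_field q v + Y v \<bullet> fiber_field q (X v)) * (Z v \<bullet> fiber_field q v)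
           + (Y v \<bullet> fiber_field q v) * (deriv_along X Z v \<bullet> fiber_field q v + Z v \<bullet> fiber_field q (X v)))" for c q
  proof -
    have der: "deriv_along X (\<lambda>w. W w \<bullet> fiber_field q w) v
        = deriv_along X W v \<bullet> fiber_field q v + W v \<bullet> fiber_field q (X v)" if "smooth_on_sphere W" for W
      using deriv_along_inner[OF that fib v, of X q]
      by (simp add: deriv_along_fiber_field[where X = X, OF v tang(1)])
    have "deriv_along X (\<lambda>w. c * ((Y w \<bullet> fiber_field q w) * (Z w \<bullet> fiber_field q w))) v
      = c * deriv_along X (\<lambda>w. (Y w \<bullet> fiber_field q w) * (Z w \<bullet> fiber_field q w)) v"
      by (intro deriv_along_scaleR_const[OF _ v] smooth fib)
    also have "deriv_along X (\<lambda>w. (Y w \<bullet> fiber_field q w) * (Z w \<bullet> fiber_field q w)) v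
      = deriv_along X (\<lambda>w. Y w \<bullet> fiber_field q w) v * (Z v \<bullet> fiber_field q v)
      + (Y v \<bullet> fiber_field q v) * deriv_along X (\<lambda>w. Z w \<bullet> fiber_field q w) v"
      by (intro deriv_along_mult[OF _ _ v] smooth fib)
    finally show ?thesis
      by (simp add: der[OF vector_fieldD(1)[OF Y]] der[OF vector_fieldD(1)[OF Z]])
  qed
  have "deriv_along X (\<lambda>w. hopf_metric t1 t2 t3 w (Y w) (Z w)) v
    = deriv_along X (\<lambda>w. Y w \<bullet> Z w + (t1 - 1) * ((Y w \<bullet> X1 w) * (Z w \<bullet> X1 w))
       + (t2 - 1) * ((Y w \<bullet> X2 w) * (Z w \<bullet> X2 w)) + (t3 - 1) * ((Y w \<bullet> X3 w) * (Z w \<bullet> X3 w))) v"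
    by (rule deriv_along_cong[OF _ _ v, symmetric])
      (intro smooth fib, simp add: hopf_metric_eq mult.assoc)
  also have "\<dots> = ?g (deriv_along X Y v) (Z v) + ?g (Y v) (deriv_along X Z v)
       + ((t1 - 1) * ((Y v \<bullet> X1 (X v)) * (Z v \<bullet> X1 v) + (Y v \<bullet> X1 v) * (Z v \<bullet> X1 (X v)))
       + (t2 - 1) * ((Y v \<bullet> X2 (X v)) * (Z v \<bullet> X2 v) + (Y v \<bullet> X2 v) * (Z v \<bullet> X2 (X v)))
       + (t3 - 1) * ((Y v \<bullet> X3 (X v)) * (Z v \<bullet> X3 v) + (Y v \<bullet> X3 v) * (Z v \<bullet> X3 (X v))))"
    by (subst deriv_along_add[OF _ _ v], (intro smooth fib)[], (intro smooth fib)[])+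
      (simp add: Q deriv_along_inner[OF Y[THEN vector_fieldD(1)] Z[THEN vector_fieldD(1)] v]
        hopf_metric_eq[OF v], simp add: algebra_simps)
  also have "\<dots> = ?g (hopf_connection t1 t2 t3 X Y v) (Z v) + ?g (Y v) (hopf_connection t1 t2 t3 X Z v)"
  proof -
    have 1: "?g (hopf_connection t1 t2 t3 X Y v) (Z v)
        = ?g (deriv_along X Y v) (Z v) + ?g (christoffel t1 t2 t3 v (X v) (Y v)) (Z v)"
      unfolding hopf_connection_def by (simp add: bilinear_ladd[OF hopf_metric_bilinear] gv)
    have 2: "?g (Y v) (hopf_connection t1 t2 t3 X Z v)
        = ?g (Y v) (deriv_along X Z v) + ?g (christoffel t1 t2 t3 v (X v) (Z v)) (Y v)"
      unfolding hopf_connection_def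
      by (simp add: bilinear_radd[OF hopf_metric_bilinear] gv hopf_metric_sym[of _ _ _ _ "Y v" "christoffel t1 t2 t3 v (X v) (Z v)"])
    show ?thesis
      unfolding 1 2 hopf_metric_christoffel[OF v tang(3,1,2) t] hopf_metric_christoffel[OF v tang(2,1,3) t]
      using fiber_field_skew[of "Z v" "Y v"]
      by (simp add: fiber_field_skew[of "Y v" "Z v"] inner_commute[of "fiber_field _ (X v)"]
        inner_commute[of "fiber_field _ (Z v)" "Y v"] algebra_simps)
  qed
  finally show ?thesis .
qed

lemma is_levi_civita_hopf_connection:
  assumes "t1 > 0" "t2 > 0" "t3 > 0"
  shows "is_levi_civita (hopf_metric t1 t2 t3) (hopf_connection t1 t2 t3)"
  unfolding is_levi_civita_def
proof (intro conjI allI impI ballI)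
  fix X Y :: "quat ^ 'm \<Rightarrow> quat ^ 'm" and v :: "quat ^ 'm"
  show "hopf_connection t1 t2 t3 X Y v - hopf_connection t1 t2 t3 Y X v = lie_bracket X Y v"
    by (simp add: hopf_connection_def lie_bracket_def christoffel_sym[of t1 t2 t3 v "X v"] inner_commute[of "X v"])
qed (rule affine_connection_hopf hopf_connection_metric[OF _ _ _ _ assms]; assumption)+

lemma levi_civita_hopf_metric:
  assumes t: "t1 > 0" "t2 > 0" "t3 > 0" and "vector_field X" "vector_field Y" "v \<in> sphere 0 1"
  shows "levi_civita (hopf_metric t1 t2 t3) X Y v = hopf_connection t1 t2 t3 X Y v"
proof -
  note LC = is_levi_civita_hopf_connection[OF t]
  have "is_levi_civita (hopf_metric t1 t2 t3) (levi_civita (hopf_metric t1 t2 t3))"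
    unfolding levi_civita_def using LC by (rule someI[of "is_levi_civita (hopf_metric t1 t2 t3)"])
  then show ?thesis
    by (rule levi_civita_unique[OF _ LC hopf_metric_pos[OF t] hopf_metric_bilinear hopf_metric_sym assms(4-6)])
qed

section \<open>The curvature tensor\<close>

text \<open>The curvature tensor of the round connection plus \<open>S\<close>: the round curvature, the
antisymmetrised derivative of \<open>S\<close> and the commutator of \<open>S\<close>. Ambient derivatives are used,
so that correction terms along \<open>v\<close> and with \<open>v\<close> as an argument of \<open>S\<close> appear; the former are
invisible to the metric.\<close>

definition hopf_riemann ::
    "real \<Rightarrow> real \<Rightarrow> real \<Rightarrow> quat ^ 'm \<Rightarrow> quat ^ 'm \<Rightarrow> quat ^ 'm \<Rightarrow> quat ^ 'm \<Rightarrow> quat ^ ('m::finite)" where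
  "hopf_riemann t1 t2 t3 v x y z =
     (y \<bullet> z) *\<^sub>R x - (x \<bullet> z) *\<^sub>R y
   + (dchristoffel t1 t2 t3 v x y z - dchristoffel t1 t2 t3 v y x z)
   + ((y \<bullet> z) *\<^sub>R christoffel t1 t2 t3 v x v - (x \<bullet> z) *\<^sub>R christoffel t1 t2 t3 v y v)
   + (christoffel t1 t2 t3 v x (christoffel t1 t2 t3 v y z)
      - christoffel t1 t2 t3 v y (christoffel t1 t2 t3 v x z))
   + (x \<bullet> christoffel t1 t2 t3 v y z - y \<bullet> christoffel t1 t2 t3 v x z) *\<^sub>R v"

text \<open>The chain and product rules. Differentiation takes place along the sphere, so the derivative of the
projection \<open>sgn\<close> acts as the identity on the tangent vector \<open>X v\<close>.\<close>

lemma deriv_along_deriv_along: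
  fixes Y :: "'a::euclidean_space \<Rightarrow> 'a" and Z :: "'a \<Rightarrow> 'b::real_normed_vector"
  assumes Y: "smooth_on_sphere Y" and Z: "smooth_on_sphere Z" and v: "v \<in> sphere 0 1" and x: "X v \<bullet> v = 0"
  shows "deriv_along X (deriv_along Y Z) v
     = frechet_derivative (\<lambda>p. frechet_derivative (\<lambda>w. Z (sgn w)) (at p) (Y v)) (at v) (X v)
     + frechet_derivative (\<lambda>w. Z (sgn w)) (at v) (deriv_along X Y v)"
proof -
  let ?Z = "\<lambda>w. Z (sgn w)" and ?Y = "\<lambda>w. Y (sgn w)"
  have sv: "sgn v = v" using v by (rule sgn_on_sphere)
  have hd: "((\<lambda>p. frechet_derivative ?Z (at p) (?Y p)) has_derivative
     (\<lambda>u. frechet_derivative (\<lambda>p. frechet_derivative ?Z (at p) (?Y v)) (at v) u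
        + frechet_derivative ?Z (at v) (frechet_derivative ?Y (at v) u))) (at (sgn v))"
    unfolding sv
    by (rule has_derivative_frechet_derivative_along[OF open_punctured Z[unfolded smooth_on_sphere_def]
        smooth_on_sphere_has_derivative[OF Y v] sphere_nonzero[OF v], unfolded sv])
  have "sgn (sgn w) = sgn w" for w :: 'a
    using sgn_on_sphere[OF sgn_in_sphere[of w]] by (cases "w = 0") auto
  then have "((\<lambda>w. deriv_along Y Z (sgn w)) has_derivative
     (\<lambda>u. frechet_derivative (\<lambda>p. frechet_derivative ?Z (at p) (?Y v)) (at v) (u - (u \<bullet> v) *\<^sub>R v)
        + frechet_derivative ?Z (at v) (frechet_derivative ?Y (at v) (u - (u \<bullet> v) *\<^sub>R v)))) (at v)"
    using diff_chain_at[OF sgn_has_derivative[OF v] hd] by (simp add: o_def deriv_along_def)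
  from deriv_along_eqI[OF this, of X] show ?thesis
    by (simp add: deriv_along_def x sv)
qed

lemma deriv_along_christoffel:
  fixes Y Z :: "quat ^ 'm \<Rightarrow> quat ^ ('m::finite)"
  assumes Y: "smooth_on_sphere Y" and Z: "smooth_on_sphere Z" and v: "v \<in> sphere 0 1" and x: "X v \<bullet> v = 0"
  shows "deriv_along X (\<lambda>w. christoffel t1 t2 t3 w (Y w) (Z w)) v
     = dchristoffel t1 t2 t3 v (X v) (Y v) (Z v) + christoffel t1 t2 t3 v (deriv_along X Y v) (Z v)
       + christoffel t1 t2 t3 v (Y v) (deriv_along X Z v)"
  using deriv_along_eqI[OF christoffel_has_derivative[OF sgn_has_derivative[OF v]
      smooth_on_sphere_has_derivative[OF Y v] smooth_on_sphere_has_derivative[OF Z v], of t1 t2 t3], of X]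
  by (simp add: deriv_along_def x sgn_on_sphere[OF v])

lemma deriv_along_hopf_connection:
  fixes X Y Z :: "quat ^ 'm \<Rightarrow> quat ^ ('m::finite)"
  assumes X: "vector_field X" and Y: "vector_field Y" and Z: "vector_field Z" and v: "v \<in> sphere 0 1"
  shows "deriv_along X (hopf_connection t1 t2 t3 Y Z) v
     = frechet_derivative (\<lambda>p. frechet_derivative (\<lambda>w. Z (sgn w)) (at p) (Y v)) (at v) (X v)
     + frechet_derivative (\<lambda>w. Z (sgn w)) (at v) (deriv_along X Y v)
     + (deriv_along X Y v \<bullet> Z v + Y v \<bullet> deriv_along X Z v) *\<^sub>R v + (Y v \<bullet> Z v) *\<^sub>R X v
     + dchristoffel t1 t2 t3 v (X v) (Y v) (Z v) + christoffel t1 t2 t3 v (deriv_along X Y v) (Z v)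
     + christoffel t1 t2 t3 v (Y v) (deriv_along X Z v)"
proof -
  note sm = X[THEN vector_fieldD(1)] Y[THEN vector_fieldD(1)] Z[THEN vector_fieldD(1)]
  have x: "X v \<bullet> v = 0" using vector_fieldD(2)[OF X v] .
  have 1: "deriv_along X (hopf_connection t1 t2 t3 Y Z) v
    = deriv_along X (deriv_along Y Z) v + deriv_along X (\<lambda>w. (Y w \<bullet> Z w) *\<^sub>R w) v
      + deriv_along X (\<lambda>w. christoffel t1 t2 t3 w (Y w) (Z w)) v"
    unfolding hopf_connection_def[abs_def]
    by (subst deriv_along_add[OF _ _ v], (intro smooth_on_sphere_add smooth_on_sphere_scaleR smooth_on_sphere_inner
      smooth_on_sphere_ident smooth_on_sphere_deriv_along smooth_on_sphere_christoffel sm)[],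
      (intro smooth_on_sphere_add smooth_on_sphere_scaleR smooth_on_sphere_inner
      smooth_on_sphere_ident smooth_on_sphere_deriv_along smooth_on_sphere_christoffel sm)[])+ simp
  have 2: "deriv_along X (\<lambda>w. (Y w \<bullet> Z w) *\<^sub>R w) v
      = (deriv_along X Y v \<bullet> Z v + Y v \<bullet> deriv_along X Z v) *\<^sub>R v + (Y v \<bullet> Z v) *\<^sub>R X v"
    using deriv_along_scaleR[OF smooth_on_sphere_inner[OF sm(2,3)] smooth_on_sphere_ident v, of X]
    by (simp add: deriv_along_inner[OF sm(2,3) v] deriv_along_ident[of v X, OF v x])
  show ?thesis
    unfolding 1 2 deriv_along_deriv_along[where X = X, OF sm(2,3) v x]
      deriv_along_christoffel[where X = X, OF sm(2,3) v x]
    by (simp add: algebra_simps)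
qed

text \<open>All derivatives of \<open>X\<close>, \<open>Y\<close>, \<open>Z\<close> cancel: the second derivatives of \<open>Z\<close> by symmetry, those of the form
\<open>dZ(dY X)\<close> and \<open>S(dY X, Z)\<close> against the bracket term, and \<open>S(Y, dZ X)\<close> against its mirror image.\<close>

lemma curvature_tensor_hopf_metric:
  fixes X Y Z :: "quat ^ 'm \<Rightarrow> quat ^ ('m::finite)"
  assumes X: "vector_field X" and Y: "vector_field Y" and Z: "vector_field Z" and v: "v \<in> sphere 0 1"
    and t: "t1 > 0" "t2 > 0" "t3 > 0"
  shows "curvature_tensor (hopf_metric t1 t2 t3) X Y Z v = hopf_riemann t1 t2 t3 v (X v) (Y v) (Z v)"
proof -
  let ?D = "levi_civita (hopf_metric t1 t2 t3 :: (quat ^ 'm) metric)" and ?H = "hopf_connection t1 t2 t3"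
  let ?S = "christoffel t1 t2 t3 v"
  note sm = X[THEN vector_fieldD(1)] Y[THEN vector_fieldD(1)] Z[THEN vector_fieldD(1)]
  have LC: "?D U W w = ?H U W w" if "vector_field U" "vector_field W" "w \<in> sphere 0 1" for U W w
    using levi_civita_hopf_metric[OF t that] .
  have iterated: "?D U (?D W Z) v = deriv_along U (?H W Z) v + (U v \<bullet> ?H W Z v) *\<^sub>R v + ?S (U v) (?H W Z v)"
    if "vector_field U" "vector_field W" for U W
  proof -
    \<comment> \<open>the chosen connection is known on the sphere only, which suffices for differentiating\<close>
    have eq: "?H W Z w = ?D W Z w" if "w \<in> sphere 0 1" for w
      using LC[OF \<open>vector_field W\<close> Z that] by simp
    have sH: "smooth_on_sphere (?H W Z)"
      using vector_field_hopf_connection[OF that(2) Z] vector_fieldD(1) by blast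
    have "?D W Z w \<bullet> w = 0" if "w \<in> sphere 0 1" for w
      using vector_fieldD(2)[OF vector_field_hopf_connection[OF \<open>vector_field W\<close> Z, of t1 t2 t3] that] eq[OF that] by simp
    then have "vector_field (?D W Z)"
      using smooth_on_sphere_cong[OF sH eq] by (simp add: vector_field_def)
    then have "?D U (?D W Z) v = ?H U (?D W Z) v"
      using LC[OF that(1) _ v] by blast
    also have "\<dots> = deriv_along U (?D W Z) v + (U v \<bullet> ?D W Z v) *\<^sub>R v + ?S (U v) (?D W Z v)"
      by (rule hopf_connection_def)
    also have "deriv_along U (?D W Z) v = deriv_along U (?H W Z) v"
      by (rule deriv_along_cong[OF sH _ v, symmetric]) (rule eq)
    finally show ?thesis by (simp only: eq[OF v])
  qed
  have sym: "frechet_derivative (\<lambda>p. frechet_derivative (\<lambda>w. Z (sgn w)) (at p) (Y v)) (at v) (X v)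
    = frechet_derivative (\<lambda>p. frechet_derivative (\<lambda>w. Z (sgn w)) (at p) (X v)) (at v) (Y v)"
    by (rule mixed_derivatives_commute[OF open_punctured sm(3)[unfolded smooth_on_sphere_def] sphere_nonzero[OF v]])
  have lin: "linear (frechet_derivative (\<lambda>w. Z (sgn w)) (at v))"
    by (rule has_derivative_linear[OF smooth_on_sphere_has_derivative[OF sm(3) v]])
  have br: "?D (lie_bracket X Y) Z v = frechet_derivative (\<lambda>w. Z (sgn w)) (at v) (deriv_along X Y v)
      - frechet_derivative (\<lambda>w. Z (sgn w)) (at v) (deriv_along Y X v)
      + ((deriv_along X Y v - deriv_along Y X v) \<bullet> Z v) *\<^sub>R v
      + (?S (deriv_along X Y v) (Z v) - ?S (deriv_along Y X v) (Z v))"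
    unfolding LC[OF vector_field_lie_bracket[OF X Y] Z v] hopf_connection_def
    by (simp add: lie_bracket_def deriv_along_def linear_diff[OF lin] christoffel_diff)
  have S: "?S x (a + b) = ?S x a + ?S x b" "?S x (c *\<^sub>R a) = c *\<^sub>R ?S x a" for x a b c
    by (rule christoffel_linear_right)+
  show ?thesis
    unfolding curvature_tensor_def Let_def iterated[OF X Y] iterated[OF Y X] br
      deriv_along_hopf_connection[OF X Y Z v] deriv_along_hopf_connection[OF Y X Z v] sym
    unfolding hopf_connection_def hopf_riemann_def S
    by (simp add: inner_add_right inner_diff_left scaleR_add_left scaleR_diff_left
        vector_fieldD(2)[OF X v] vector_fieldD(2)[OF Y v] algebra_simps)
qed

lemma hopf_metric_hopf_riemann:
  fixes x y v :: "quat ^ ('m::finite)"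
  assumes v: "v \<in> sphere 0 1" and x: "x \<bullet> v = 0"
  shows "hopf_metric t1 t2 t3 v (hopf_riemann t1 t2 t3 v x y y) x
   = hopf_metric t1 t2 t3 v ((y \<bullet> y) *\<^sub>R x - (x \<bullet> y) *\<^sub>R y) x
   + (hopf_metric t1 t2 t3 v (dchristoffel t1 t2 t3 v x y y) x
   - hopf_metric t1 t2 t3 v (dchristoffel t1 t2 t3 v y x y) x)
   + ((y \<bullet> y) * hopf_metric t1 t2 t3 v (christoffel t1 t2 t3 v x v) x
   - (x \<bullet> y) * hopf_metric t1 t2 t3 v (christoffel t1 t2 t3 v y v) x)
   + hopf_metric t1 t2 t3 v (christoffel t1 t2 t3 v x (christoffel t1 t2 t3 v y y)) x
   - hopf_metric t1 t2 t3 v (christoffel t1 t2 t3 v y (christoffel t1 t2 t3 v x y)) x"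
proof -
  have "hopf_metric t1 t2 t3 v v x = 0"
    using x by (simp add: hopf_metric_eq[OF v] inner_fiber_field_self inner_commute)
  then show ?thesis
    unfolding hopf_riemann_def
    by (simp add: bilinear_ladd[OF hopf_metric_bilinear] bilinear_lsub[OF hopf_metric_bilinear]
       bilinear_lmul[OF hopf_metric_bilinear])
qed

section \<open>The curvature of a plane in horizontal and vertical coordinates\<close>

text \<open>The curvature of the plane spanned by \<open>h + \<Sum> a_r X_r\<close> and \<open>k + \<Sum> b_r X_r\<close> as a function of the Gram
matrix \<open>hh\<close>, \<open>hk\<close>, \<open>kk\<close> of the horizontal parts, of \<open>O_r = \<langle>k, X_r h\<rangle>\<close> and of the vertical
coordinates. Without the factor \<open>t_r\<^sup>2\<close>, the last three summands are \<open>|a_r k - b_r h|\<^sup>2\<close>.\<close>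

definition hopf_biquadratic ::
  "real \<Rightarrow> real \<Rightarrow> real \<Rightarrow> real \<Rightarrow> real \<Rightarrow> real \<Rightarrow> real \<Rightarrow> real \<Rightarrow> real \<Rightarrow>
   real \<Rightarrow> real \<Rightarrow> real \<Rightarrow> real \<Rightarrow> real \<Rightarrow> real \<Rightarrow> real" where
  "hopf_biquadratic t1 t2 t3 hh hk kk O1 O2 O3 a1 a2 a3 b1 b2 b3 =
     (let A1 = a2 * b3 - a3 * b2; A2 = a3 * b1 - a1 * b3; A3 = a1 * b2 - a2 * b1 in
      hh * kk - hk\<^sup>2
     + 3 * (1 - t1) * O1\<^sup>2 + 3 * (1 - t2) * O2\<^sup>2 + 3 * (1 - t3) * O3\<^sup>2
     + V_coeff t1 t2 t3 * A1\<^sup>2 + V_coeff t2 t3 t1 * A2\<^sup>2 + V_coeff t3 t1 t2 * A3\<^sup>2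
     + 6 * (t2 * t3 - t2 - t3 + t1) * A1 * O1 + 6 * (t3 * t1 - t3 - t1 + t2) * A2 * O2
     + 6 * (t1 * t2 - t1 - t2 + t3) * A3 * O3
     + t1\<^sup>2 * (a1\<^sup>2 * kk - 2 * a1 * b1 * hk + b1\<^sup>2 * hh)
     + t2\<^sup>2 * (a2\<^sup>2 * kk - 2 * a2 * b2 * hk + b2\<^sup>2 * hh)
     + t3\<^sup>2 * (a3\<^sup>2 * kk - 2 * a3 * b3 * hk + b3\<^sup>2 * hh))"

text \<open>The curvature is the sum of the contributions listed in \<open>hopf_metric_hopf_riemann\<close>, each of which is
a polynomial in the inner products of \<open>x\<close>, \<open>y\<close>, \<open>v\<close> and their images under the quaternion units.
Naming these inner products reduces everything to polynomial identities. In the sum of all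
contributions, the terms linear in \<open>e_i\<close> combine to \<open>e_i (t_k - t_j) A_i\<^sup>2\<close> with \<open>A = a \<times> b\<close>, which is
the part of \<open>V_i A_i\<^sup>2\<close> with denominator \<open>t_i\<close>.\<close>

context
  fixes v x y :: "quat ^ ('m::finite)" and t1 t2 t3 a1 a2 a3 b1 b2 b3 w1 w2 w3 xx xy yy e1 e2 e3 :: real
  assumes v: "v \<in> sphere 0 1"
  and t: "t1 > 0" "t2 > 0" "t3 > 0"
  and tang: "x \<bullet> v = 0" "y \<bullet> v = 0"
  and a: "x \<bullet> X1 v = a1" "x \<bullet> X2 v = a2" "x \<bullet> X3 v = a3"
  and b: "y \<bullet> X1 v = b1" "y \<bullet> X2 v = b2" "y \<bullet> X3 v = b3"
  and w: "x \<bullet> X1 y = w1" "x \<bullet> X2 y = w2" "x \<bullet> X3 y = w3"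
  and e: "fiber_coeff t1 t2 t3 = e1" "fiber_coeff t2 t3 t1 = e2" "fiber_coeff t3 t1 t2 = e3"
  and xy: "x \<bullet> x = xx" "x \<bullet> y = xy" "y \<bullet> y = yy"
begin

private lemma dual:
  "v \<bullet> X1 x = - a1" "v \<bullet> X2 x = - a2" "v \<bullet> X3 x = - a3"
  "v \<bullet> X1 y = - b1" "v \<bullet> X2 y = - b2" "v \<bullet> X3 y = - b3"
  "y \<bullet> X1 x = - w1" "y \<bullet> X2 x = - w2" "y \<bullet> X3 x = - w3"
  "v \<bullet> x = 0" "v \<bullet> y = 0" "y \<bullet> x = xy" "v \<bullet> v = 1"
  using a b w tang xy v fiber_field_skew[of v x] fiber_field_skew[of v y] fiber_field_skew[of y x]
  by (auto simp: inner_commute dot_square_norm)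

private lemmas reduce = inner_expand fiber_field_skew fiber_field_compose inner_fiber_field_self
  fiber_field_linear a b w e tang xy dual

private lemma fiber_coeff_mult:
  "t1 * e1 = (1 - t1) * (t3 - t2)" "t2 * e2 = (1 - t2) * (t1 - t3)" "t3 * e3 = (1 - t3) * (t2 - t1)"
  using t unfolding e[symmetric] fiber_coeff_def by (simp_all add: field_simps)

private lemma V_coeff_eq:
  "V_coeff t1 t2 t3 = 2 * (t2 + t3) - 3 * t1 + (t3 - t2) * (e1 + t3 - t2)"
  "V_coeff t2 t3 t1 = 2 * (t3 + t1) - 3 * t2 + (t1 - t3) * (e2 + t1 - t3)"
  "V_coeff t3 t1 t2 = 2 * (t1 + t2) - 3 * t3 + (t2 - t1) * (e3 + t2 - t1)"
  using t unfolding e[symmetric] V_coeff_def fiber_coeff_def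
  by (simp_all add: field_simps power2_eq_square)

private lemma derivative_term_x:
  "hopf_metric t1 t2 t3 v (dchristoffel t1 t2 t3 v x y y) x
   = - 2 * ((t1 - 1) * w1\<^sup>2 + (t2 - 1) * w2\<^sup>2 + (t3 - 1) * w3\<^sup>2)
   + 2 * ((t1 - 1) * b1\<^sup>2 + (t2 - 1) * b2\<^sup>2 + (t3 - 1) * b3\<^sup>2)
       * (xx + (t1 - 1) * a1\<^sup>2 + (t2 - 1) * a2\<^sup>2 + (t3 - 1) * a3\<^sup>2)
   - 2 * ((1 - t1) * (t3 - t2) * a1 * (w2 * b3 + w3 * b2) + (1 - t2) * (t1 - t3) * a2 * (w3 * b1 + w1 * b3)
        + (1 - t3) * (t2 - t1) * a3 * (w1 * b2 + w2 * b1))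
   + 2 * ((t1 - 1) * a1 * ((t2 - 1) * w2 * b3 - (t3 - 1) * w3 * b2)
        + (t2 - 1) * a2 * ((t3 - 1) * w3 * b1 - (t1 - 1) * w1 * b3)
        + (t3 - 1) * a3 * ((t1 - 1) * w1 * b2 - (t2 - 1) * w2 * b1))
   - 2 * (e1 * (t3 - t2) * (a2 * a3 * b2 * b3) + e2 * (t1 - t3) * (a3 * a1 * b3 * b1)
        + e3 * (t2 - t1) * (a1 * a2 * b1 * b2))"
  unfolding hopf_metric_eq[OF v] dchristoffel_def fiber_coeff_mult[symmetric]
  by (simp add: reduce, simp add: algebra_simps power2_eq_square)

private lemma derivative_term_y:
  "hopf_metric t1 t2 t3 v (dchristoffel t1 t2 t3 v y x y) x
   = ((t1 - 1) * w1\<^sup>2 + (t2 - 1) * w2\<^sup>2 + (t3 - 1) * w3\<^sup>2)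
   + 2 * ((t1 - 1) * a1 * b1 + (t2 - 1) * a2 * b2 + (t3 - 1) * a3 * b3)
       * (xy + (t1 - 1) * a1 * b1 + (t2 - 1) * a2 * b2 + (t3 - 1) * a3 * b3)
   + ((1 - t1) * (t3 - t2) * a1 * (w2 * b3 + w3 * b2) + (1 - t2) * (t1 - t3) * a2 * (w3 * b1 + w1 * b3)
        + (1 - t3) * (t2 - t1) * a3 * (w1 * b2 + w2 * b1))
   - ((t1 - 1) * a1 * ((t2 - 1) * w2 * b3 - (t3 - 1) * w3 * b2)
        + (t2 - 1) * a2 * ((t3 - 1) * w3 * b1 - (t1 - 1) * w1 * b3)
        + (t3 - 1) * a3 * ((t1 - 1) * w1 * b2 - (t2 - 1) * w2 * b1))
   + (e1 * (a2 * b3 + a3 * b2) * w1 + e2 * (a3 * b1 + a1 * b3) * w2 + e3 * (a1 * b2 + a2 * b1) * w3)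
   - (e1 * (a2 * b3 + a3 * b2) * ((t3 - 1) * a3 * b2 - (t2 - 1) * a2 * b3)
    + e2 * (a3 * b1 + a1 * b3) * ((t1 - 1) * a1 * b3 - (t3 - 1) * a3 * b1)
    + e3 * (a1 * b2 + a2 * b1) * ((t2 - 1) * a2 * b1 - (t1 - 1) * a1 * b2))"
  unfolding hopf_metric_eq[OF v] dchristoffel_def fiber_coeff_mult[symmetric]
  by (simp add: reduce, simp add: algebra_simps power2_eq_square)

private lemma normal_terms:
  "hopf_metric t1 t2 t3 v (christoffel t1 t2 t3 v x v) x
    = (t1 - 1) * t1 * a1\<^sup>2 + (t2 - 1) * t2 * a2\<^sup>2 + (t3 - 1) * t3 * a3\<^sup>2"
  "hopf_metric t1 t2 t3 v (christoffel t1 t2 t3 v y v) x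
    = (t1 - 1) * t1 * a1 * b1 + (t2 - 1) * t2 * a2 * b2 + (t3 - 1) * t3 * a3 * b3"
  unfolding hopf_metric_eq[OF v] christoffel_def
  by (simp_all add: reduce, simp_all add: algebra_simps power2_eq_square)

private lemma christoffel_yy_inner:
  "christoffel t1 t2 t3 v y y \<bullet> X1 x = 2 * ((t1 - 1) * b1 * xy + ((t2 - 1) * b2 * w3 - (t3 - 1) * b3 * w2)
      - ((t1 - 1) * b1\<^sup>2 + (t2 - 1) * b2\<^sup>2 + (t3 - 1) * b3\<^sup>2) * a1 + (e2 * b3 * b1 * a3 - e3 * b1 * b2 * a2))"
  "christoffel t1 t2 t3 v y y \<bullet> X2 x = 2 * ((t2 - 1) * b2 * xy + ((t3 - 1) * b3 * w1 - (t1 - 1) * b1 * w3)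
      - ((t1 - 1) * b1\<^sup>2 + (t2 - 1) * b2\<^sup>2 + (t3 - 1) * b3\<^sup>2) * a2 + (e3 * b1 * b2 * a1 - e1 * b2 * b3 * a3))"
  "christoffel t1 t2 t3 v y y \<bullet> X3 x = 2 * ((t3 - 1) * b3 * xy + ((t1 - 1) * b1 * w2 - (t2 - 1) * b2 * w1)
      - ((t1 - 1) * b1\<^sup>2 + (t2 - 1) * b2\<^sup>2 + (t3 - 1) * b3\<^sup>2) * a3 + (e1 * b2 * b3 * a2 - e2 * b3 * b1 * a1))"
  unfolding christoffel_def
  by (simp_all add: reduce, simp_all add: algebra_simps power2_eq_square)

private lemma christoffel_xy_inner:
  "christoffel t1 t2 t3 v x y \<bullet> X1 x = (t1 - 1) * (b1 * xx + a1 * xy) + ((t2 - 1) * a2 * w3 - (t3 - 1) * a3 * w2)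
      - 2 * ((t1 - 1) * a1 * b1 + (t2 - 1) * a2 * b2 + (t3 - 1) * a3 * b3) * a1
      + (e2 * (a3 * b1 + a1 * b3) * a3 - e3 * (a1 * b2 + a2 * b1) * a2)"
  "christoffel t1 t2 t3 v x y \<bullet> X2 x = (t2 - 1) * (b2 * xx + a2 * xy) + ((t3 - 1) * a3 * w1 - (t1 - 1) * a1 * w3)
      - 2 * ((t1 - 1) * a1 * b1 + (t2 - 1) * a2 * b2 + (t3 - 1) * a3 * b3) * a2
      + (e3 * (a1 * b2 + a2 * b1) * a1 - e1 * (a2 * b3 + a3 * b2) * a3)"
  "christoffel t1 t2 t3 v x y \<bullet> X3 x = (t3 - 1) * (b3 * xx + a3 * xy) + ((t1 - 1) * a1 * w2 - (t2 - 1) * a2 * w1)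
      - 2 * ((t1 - 1) * a1 * b1 + (t2 - 1) * a2 * b2 + (t3 - 1) * a3 * b3) * a3
      + (e1 * (a2 * b3 + a3 * b2) * a2 - e2 * (a3 * b1 + a1 * b3) * a1)"
  unfolding christoffel_def
  by (simp_all add: reduce algebra_simps power2_eq_square)

private lemma christoffel_xy_fiber:
  "(t1 - 1) * (christoffel t1 t2 t3 v x y \<bullet> X1 v) = - e1 * (a2 * b3 + a3 * b2)"
  "(t2 - 1) * (christoffel t1 t2 t3 v x y \<bullet> X2 v) = - e2 * (a3 * b1 + a1 * b3)"
  "(t3 - 1) * (christoffel t1 t2 t3 v x y \<bullet> X3 v) = - e3 * (a1 * b2 + a2 * b1)"
proof -
  have *: "(t1 - 1) * (e1 + (t3 - t2)) = - e1" "(t2 - 1) * (e2 + (t1 - t3)) = - e2"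
    "(t3 - 1) * (e3 + (t2 - t1)) = - e3"
    using fiber_coeff_mult by (simp_all add: algebra_simps)
  show "(t1 - 1) * (christoffel t1 t2 t3 v x y \<bullet> X1 v) = - e1 * (a2 * b3 + a3 * b2)"
    "(t2 - 1) * (christoffel t1 t2 t3 v x y \<bullet> X2 v) = - e2 * (a3 * b1 + a1 * b3)"
    "(t3 - 1) * (christoffel t1 t2 t3 v x y \<bullet> X3 v) = - e3 * (a1 * b2 + a2 * b1)"
    unfolding inner_christoffel_fiber_field[OF v tang] e a b *[symmetric] by (simp_all only: mult.assoc)
qed

private lemma quadratic_term_x:
  "hopf_metric t1 t2 t3 v (christoffel t1 t2 t3 v x (christoffel t1 t2 t3 v y y)) x
      = - ((t1 - 1) * a1 * (christoffel t1 t2 t3 v y y \<bullet> X1 x)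
         + (t2 - 1) * a2 * (christoffel t1 t2 t3 v y y \<bullet> X2 x)
         + (t3 - 1) * a3 * (christoffel t1 t2 t3 v y y \<bullet> X3 x))"
  using hopf_metric_christoffel[OF v tang(1) tang(1) christoffel_tangent[OF v tang(2) tang(2)] t, of t1 t2 t3]
  by (simp add: reduce)

private lemma quadratic_term_y:
  "hopf_metric t1 t2 t3 v (christoffel t1 t2 t3 v y (christoffel t1 t2 t3 v x y)) x
      = - (e1 * (a2 * b3 + a3 * b2) * w1 + e2 * (a3 * b1 + a1 * b3) * w2 + e3 * (a1 * b2 + a2 * b1) * w3)
      - ((t1 - 1) * b1 * (christoffel t1 t2 t3 v x y \<bullet> X1 x)
         + (t2 - 1) * b2 * (christoffel t1 t2 t3 v x y \<bullet> X2 x)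
         + (t3 - 1) * b3 * (christoffel t1 t2 t3 v x y \<bullet> X3 x))"
proof -
  have "hopf_metric t1 t2 t3 v (christoffel t1 t2 t3 v y (christoffel t1 t2 t3 v x y)) x
      = ((t1 - 1) * (christoffel t1 t2 t3 v x y \<bullet> X1 v)) * w1
      + ((t2 - 1) * (christoffel t1 t2 t3 v x y \<bullet> X2 v)) * w2
      + ((t3 - 1) * (christoffel t1 t2 t3 v x y \<bullet> X3 v)) * w3
      - ((t1 - 1) * b1 * (christoffel t1 t2 t3 v x y \<bullet> X1 x)
         + (t2 - 1) * b2 * (christoffel t1 t2 t3 v x y \<bullet> X2 x)
         + (t3 - 1) * b3 * (christoffel t1 t2 t3 v x y \<bullet> X3 x))"
    using hopf_metric_christoffel[OF v tang(1) tang(2) christoffel_tangent[OF v tang(1) tang(2)] t, of t1 t2 t3]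
    by (simp add: fiber_field_skew a b w dual) (simp add: algebra_simps)
  then show ?thesis unfolding christoffel_xy_fiber by simp
qed

private lemma round_term:
  "hopf_metric t1 t2 t3 v (yy *\<^sub>R x - xy *\<^sub>R y) x = yy * xx - xy * xy
     + ((t1 - 1) * (yy * a1 - xy * b1) * a1 + (t2 - 1) * (yy * a2 - xy * b2) * a2 + (t3 - 1) * (yy * a3 - xy * b3) * a3)"
  unfolding hopf_metric_eq[OF v]
  by (simp add: reduce)

lemma hopf_curvature_in_coordinates:
  "hopf_metric t1 t2 t3 v (yy *\<^sub>R x - xy *\<^sub>R y) x
   + (hopf_metric t1 t2 t3 v (dchristoffel t1 t2 t3 v x y y) x
   - hopf_metric t1 t2 t3 v (dchristoffel t1 t2 t3 v y x y) x)
   + (yy * hopf_metric t1 t2 t3 v (christoffel t1 t2 t3 v x v) x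
   - xy * hopf_metric t1 t2 t3 v (christoffel t1 t2 t3 v y v) x)
   + hopf_metric t1 t2 t3 v (christoffel t1 t2 t3 v x (christoffel t1 t2 t3 v y y)) x
   - hopf_metric t1 t2 t3 v (christoffel t1 t2 t3 v y (christoffel t1 t2 t3 v x y)) x
   = hopf_biquadratic t1 t2 t3
       (xx - a1\<^sup>2 - a2\<^sup>2 - a3\<^sup>2) (xy - a1 * b1 - a2 * b2 - a3 * b3) (yy - b1\<^sup>2 - b2\<^sup>2 - b3\<^sup>2)
       ((a2 * b3 - a3 * b2) - w1) ((a3 * b1 - a1 * b3) - w2) ((a1 * b2 - a2 * b1) - w3)
       a1 a2 a3 b1 b2 b3"
  unfolding round_term derivative_term_x derivative_term_y normal_terms quadratic_term_x quadratic_term_y christoffel_yy_inner christoffel_xy_inner V_coeff_eq hopf_biquadratic_def Let_def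
  by (simp add: algebra_simps power2_eq_square)

end

text \<open>The inner products of \<open>x\<close> and \<open>y\<close> in terms of their horizontal parts and vertical coordinates; the
vertical parts contribute \<open>- A_r\<close> to \<open>\<langle>y, X_r x\<rangle>\<close>, which turns it into \<open>O_r - A_r\<close>.\<close>

lemma hopf_curvature_formula:
  fixes h k v :: "quat ^ ('m::finite)"
  assumes v: "v \<in> sphere 0 1" and t: "t1 > 0" "t2 > 0" "t3 > 0"
    and h: "h \<bullet> v = 0" "h \<bullet> X1 v = 0" "h \<bullet> X2 v = 0" "h \<bullet> X3 v = 0"
    and k: "k \<bullet> v = 0" "k \<bullet> X1 v = 0" "k \<bullet> X2 v = 0" "k \<bullet> X3 v = 0"
    and x: "x = h + a1 *\<^sub>R X1 v + a2 *\<^sub>R X2 v + a3 *\<^sub>R X3 v"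
    and y: "y = k + b1 *\<^sub>R X1 v + b2 *\<^sub>R X2 v + b3 *\<^sub>R X3 v"
  shows "hopf_metric t1 t2 t3 v (hopf_riemann t1 t2 t3 v x y y) x
    = hopf_biquadratic t1 t2 t3 (h \<bullet> h) (h \<bullet> k) (k \<bullet> k) (k \<bullet> X1 h) (k \<bullet> X2 h) (k \<bullet> X3 h) a1 a2 a3 b1 b2 b3"
proof -
  have vv: "v \<bullet> v = 1" using v by (simp add: dot_square_norm)
  note dual = h k h[unfolded inner_commute[of h]] k[unfolded inner_commute[of k]]
  have "v \<bullet> X1 h = 0" "v \<bullet> X2 h = 0" "v \<bullet> X3 h = 0" "v \<bullet> X1 k = 0" "v \<bullet> X2 k = 0" "v \<bullet> X3 k = 0"
    using h k fiber_field_skew[of v h] fiber_field_skew[of v k] by (simp_all add: inner_commute)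
  note dual = dual this
  have tang: "x \<bullet> v = 0" "y \<bullet> v = 0"
    by (simp_all add: x y inner_add_left dual fiber_field_tangent)
  have a: "x \<bullet> X1 v = a1" "x \<bullet> X2 v = a2" "x \<bullet> X3 v = a3"
    by (simp_all add: x inner_add_left dual fiber_field_skew fiber_field_compose inner_fiber_field_self vv)
  have b: "y \<bullet> X1 v = b1" "y \<bullet> X2 v = b2" "y \<bullet> X3 v = b3"
    by (simp_all add: y inner_add_left dual fiber_field_skew fiber_field_compose inner_fiber_field_self vv)
  have flip: "k \<bullet> X1 h = - (h \<bullet> X1 k)" "k \<bullet> X2 h = - (h \<bullet> X2 k)" "k \<bullet> X3 h = - (h \<bullet> X3 k)"
    using fiber_field_skew[of k h] by (simp_all add: inner_commute)
  have w: "x \<bullet> X1 y = h \<bullet> X1 k + (a2 * b3 - a3 * b2)" "x \<bullet> X2 y = h \<bullet> X2 k + (a3 * b1 - a1 * b3)"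
    "x \<bullet> X3 y = h \<bullet> X3 k + (a1 * b2 - a2 * b1)"
    by (simp_all add: x y inner_expand dual fiber_field_skew fiber_field_compose fiber_field_linear
        inner_fiber_field_self vv)
  have xy: "x \<bullet> x = h \<bullet> h + a1\<^sup>2 + a2\<^sup>2 + a3\<^sup>2" "y \<bullet> y = k \<bullet> k + b1\<^sup>2 + b2\<^sup>2 + b3\<^sup>2"
    "x \<bullet> y = h \<bullet> k + a1 * b1 + a2 * b2 + a3 * b3"
    by (simp_all add: x y inner_expand dual fiber_field_skew fiber_field_compose fiber_field_linear
        inner_fiber_field_self vv power2_eq_square)
  show ?thesis
    unfolding hopf_metric_hopf_riemann[OF v tang(1)]
    unfolding hopf_curvature_in_coordinates[OF v t tang a b refl refl refl refl refl refl refl refl refl]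
    unfolding w xy flip by simp
qed

section \<open>Positivity of the biquadratic form\<close>

text \<open>Bessel's inequality for \<open>k\<close> and the orthogonal vectors \<open>h, X_1 h, X_2 h, X_3 h\<close> of equal length.
Equality holds if \<open>k\<close> lies in the quaternionic line of \<open>h\<close>.\<close>

lemma quaternionic_Bessel:
  fixes h k :: "quat ^ ('m::finite)"
  shows "(k \<bullet> X1 h)\<^sup>2 + (k \<bullet> X2 h)\<^sup>2 + (k \<bullet> X3 h)\<^sup>2 \<le> (h \<bullet> h) * (k \<bullet> k) - (h \<bullet> k)\<^sup>2"
proof (cases "h = 0")
  case True
  then show ?thesis by (simp add: fiber_field_linear)
next
  case False
  \<comment> \<open>\<open>|h|\<^sup>2\<close> times the component of \<open>k\<close> orthogonal to the quaternionic line of \<open>h\<close>\<close>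
  define p where "p = (h \<bullet> h) *\<^sub>R k - (h \<bullet> k) *\<^sub>R h - (k \<bullet> X1 h) *\<^sub>R X1 h - (k \<bullet> X2 h) *\<^sub>R X2 h - (k \<bullet> X3 h) *\<^sub>R X3 h"
  have flip: "h \<bullet> X1 k = - (k \<bullet> X1 h)" "h \<bullet> X2 k = - (k \<bullet> X2 h)" "h \<bullet> X3 k = - (k \<bullet> X3 h)" "k \<bullet> h = h \<bullet> k"
    using fiber_field_skew[of k h] by (simp_all add: inner_commute)
  have "p \<bullet> p = (h \<bullet> h) * ((h \<bullet> h) * (k \<bullet> k) - (h \<bullet> k)\<^sup>2 - ((k \<bullet> X1 h)\<^sup>2 + (k \<bullet> X2 h)\<^sup>2 + (k \<bullet> X3 h)\<^sup>2))"
    by (simp add: p_def inner_expand fiber_field_skew fiber_field_compose inner_fiber_field_self flip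
        algebra_simps power2_eq_square)
  then have "(h \<bullet> h) * ((h \<bullet> h) * (k \<bullet> k) - (h \<bullet> k)\<^sup>2 - ((k \<bullet> X1 h)\<^sup>2 + (k \<bullet> X2 h)\<^sup>2 + (k \<bullet> X3 h)\<^sup>2)) \<ge> 0"
    by (metis inner_ge_zero)
  moreover have "h \<bullet> h > 0" using False by simp
  ultimately show ?thesis by (simp add: zero_le_mult_iff)
qed

text \<open>For the symmetric matrices \<open>G = (p, q; q, r)\<close> and \<open>G' = (r', - q'; - q', p')\<close> this is
\<open>4 det G det G' \<le> (tr G G')\<^sup>2\<close>. If both are positive semidefinite, then the eigenvalues of \<open>G G'\<close> are
nonnegative and their arithmetic mean dominates the geometric one; if \<open>det G' < 0\<close>, then the left-hand
side is not positive. The proof treats both cases at once and avoids eigenvalues.\<close>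

lemma gram_mixed_discriminant:
  fixes p q r p' q' r' :: real
  assumes "p \<ge> 0" "r \<ge> 0" "q\<^sup>2 \<le> p * r" "p' \<ge> 0" "r' \<ge> 0"
  shows "4 * ((p * r - q\<^sup>2) * (p' * r' - q'\<^sup>2)) \<le> (p * r' + r * p' - 2 * q * q')\<^sup>2"
proof -
  let ?u = "p * q' - p' * q" and ?w = "r * q' - r' * q"
  have eq: "(p * r' + r * p' - 2 * q * q')\<^sup>2 - 4 * ((p * r - q\<^sup>2) * (p' * r' - q'\<^sup>2))
     = (p * r' - r * p')\<^sup>2 + 4 * (?u * ?w)"
    by (simp add: algebra_simps power2_eq_square)
  have "(p * r' - r * p')\<^sup>2 + 4 * (?u * ?w) \<ge> 0"
  proof (cases "?u * ?w \<ge> 0 \<or> q = 0")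
    case True
    then show ?thesis
    proof
      assume "q = 0"
      then have "?u * ?w = (p * r) * q'\<^sup>2" by (simp add: power2_eq_square)
      then show ?thesis using assms by simp
    qed simp
  next
    case False
    \<comment> \<open>after multiplication by \<open>q\<^sup>2\<close> the difference becomes a square plus a product of nonnegative factors\<close>
    have "q\<^sup>2 * ((p * r' - r * p')\<^sup>2 + 4 * (?u * ?w)) = (r * ?u - p * ?w)\<^sup>2 + 4 * q\<^sup>2 * (?u * ?w)"
      by (simp add: algebra_simps power2_eq_square)
    also have "\<dots> = (r * ?u + p * ?w)\<^sup>2 + 4 * ((p * r - q\<^sup>2) * - (?u * ?w))"
      by (simp add: algebra_simps power2_eq_square)
    also have "\<dots> \<ge> 0"
      using False assms(3) by (intro add_nonneg_nonneg mult_nonneg_nonneg) auto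
    finally show ?thesis using False by (simp add: zero_le_mult_iff)
  qed
  then show ?thesis using eq by linarith
qed

lemma binary_form_pos:
  fixes V H m x y :: real
  assumes "V > 0" "H > 0" "m < sqrt (H * V)" "x \<noteq> 0 \<or> y \<noteq> 0"
  shows "V * x\<^sup>2 + H * y\<^sup>2 - 2 * m * \<bar>x * y\<bar> > 0"
proof (cases "x * y = 0")
  case True
  have "V * x\<^sup>2 + H * y\<^sup>2 > 0"
    using assms by (cases "x = 0") (auto simp: add_pos_nonneg)
  then show ?thesis using True by auto
next
  case False
  have "0 \<le> (sqrt V * \<bar>x\<bar> - sqrt H * \<bar>y\<bar>)\<^sup>2" by simp
  also have "\<dots> = V * x\<^sup>2 + H * y\<^sup>2 - 2 * sqrt (H * V) * \<bar>x * y\<bar>"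
    using assms by (simp add: power2_diff power_mult_distrib real_sqrt_mult abs_mult)
  also have "\<dots> < V * x\<^sup>2 + H * y\<^sup>2 - 2 * m * \<bar>x * y\<bar>"
    using assms False by simp
  finally show ?thesis .
qed

text \<open>The condition of the theorem for one cyclic permutation. It says that the binary form
\<open>V A\<^sup>2 + H W\<^sup>2 + 6 \<tau> A W + 2 t_j t_k |A W|\<close> with \<open>\<tau> = t_j t_k - t_j - t_k + t_i\<close> is positive
definite, by comparison of \<open>V A\<^sup>2 + H W\<^sup>2\<close> with \<open>2 sqrt (H V) |A W|\<close>.\<close>

definition curvature_condition :: "real \<Rightarrow> real \<Rightarrow> real \<Rightarrow> bool" where
  "curvature_condition ti tj tk \<longleftrightarrow> V_coeff ti tj tk > 0 \<and> H_coeff ti > 0 \<and>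
     3 * \<bar>tj * tk - tj - tk + ti\<bar> < tj * tk + sqrt (H_coeff ti * V_coeff ti tj tk)"

lemma curvature_condition_term:
  assumes c: "curvature_condition ti tj tk"
  shows "V_coeff ti tj tk * A\<^sup>2 + H_coeff ti * W\<^sup>2 + 6 * (tj * tk - tj - tk + ti) * A * W + 2 * (tj * tk) * \<bar>A * W\<bar> \<ge> 0"
    and "A \<noteq> 0 \<or> W \<noteq> 0 \<Longrightarrow>
      V_coeff ti tj tk * A\<^sup>2 + H_coeff ti * W\<^sup>2 + 6 * (tj * tk - tj - tk + ti) * A * W + 2 * (tj * tk) * \<bar>A * W\<bar> > 0"
proof -
  let ?E = "V_coeff ti tj tk * A\<^sup>2 + H_coeff ti * W\<^sup>2 + 6 * (tj * tk - tj - tk + ti) * A * W + 2 * (tj * tk) * \<bar>A * W\<bar>"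
  show pos: "?E > 0" if "A \<noteq> 0 \<or> W \<noteq> 0"
  proof -
    let ?m = "3 * \<bar>tj * tk - tj - tk + ti\<bar> - tj * tk"
    have "\<bar>(tj * tk - tj - tk + ti) * (A * W)\<bar> = \<bar>tj * tk - tj - tk + ti\<bar> * \<bar>A * W\<bar>"
      by (rule abs_mult)
    then have "(tj * tk - tj - tk + ti) * (A * W) \<ge> - (\<bar>tj * tk - tj - tk + ti\<bar> * \<bar>A * W\<bar>)"
      by linarith
    then have "?E \<ge> V_coeff ti tj tk * A\<^sup>2 + H_coeff ti * W\<^sup>2 - 2 * ?m * \<bar>A * W\<bar>"
      by (simp add: algebra_simps)
    moreover have "V_coeff ti tj tk * A\<^sup>2 + H_coeff ti * W\<^sup>2 - 2 * ?m * \<bar>A * W\<bar> > 0"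
      using c that unfolding curvature_condition_def by (intro binary_form_pos) auto
    ultimately show ?thesis by linarith
  qed
  show "?E \<ge> 0" using pos by (cases "A \<noteq> 0 \<or> W \<noteq> 0") auto
qed

lemma three_term_Cauchy:
  fixes x1 x2 x3 y1 y2 y3 :: real
  shows "(x1 * y1 + x2 * y2 + x3 * y3)\<^sup>2 \<le> (x1\<^sup>2 + x2\<^sup>2 + x3\<^sup>2) * (y1\<^sup>2 + y2\<^sup>2 + y3\<^sup>2)"
proof -
  have "(x1\<^sup>2 + x2\<^sup>2 + x3\<^sup>2) * (y1\<^sup>2 + y2\<^sup>2 + y3\<^sup>2) - (x1 * y1 + x2 * y2 + x3 * y3)\<^sup>2
    = (x1 * y2 - x2 * y1)\<^sup>2 + (x2 * y3 - x3 * y2)\<^sup>2 + (x3 * y1 - x1 * y3)\<^sup>2"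
    by (simp add: algebra_simps power2_eq_square)
  moreover have "\<dots> \<ge> 0" by simp
  ultimately show ?thesis by linarith
qed

text \<open>With \<open>p = (t_r a_r)\<close> and \<open>q = (t_r b_r)\<close> the right-hand side is \<open>|h \<otimes> q - k \<otimes> p|\<^sup>2\<close>, expressed by the two
Gram matrices. By \<open>gram_mixed_discriminant\<close> it is at least \<open>2 |h\<and>k| |p\<and>q|\<close>. Since
\<open>|h\<and>k|\<close> dominates the length of \<open>O\<close> and the components of \<open>p \<times> q\<close> are \<open>t_j t_k A_i\<close>, Cauchy's
inequality finishes the proof.\<close>

lemma mixed_term_bound:
  fixes t1 t2 t3 hh hk kk O1 O2 O3 a1 a2 a3 b1 b2 b3 :: real
  assumes t: "t1 > 0" "t2 > 0" "t3 > 0" and hh: "hh \<ge> 0" "kk \<ge> 0"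
    and O: "O1\<^sup>2 + O2\<^sup>2 + O3\<^sup>2 \<le> hh * kk - hk\<^sup>2"
  shows "2 * (t2 * t3) * \<bar>(a2 * b3 - a3 * b2) * O1\<bar> + 2 * (t3 * t1) * \<bar>(a3 * b1 - a1 * b3) * O2\<bar>
      + 2 * (t1 * t2) * \<bar>(a1 * b2 - a2 * b1) * O3\<bar>
    \<le> t1\<^sup>2 * (a1\<^sup>2 * kk - 2 * a1 * b1 * hk + b1\<^sup>2 * hh) + t2\<^sup>2 * (a2\<^sup>2 * kk - 2 * a2 * b2 * hk + b2\<^sup>2 * hh)
     + t3\<^sup>2 * (a3\<^sup>2 * kk - 2 * a3 * b3 * hk + b3\<^sup>2 * hh)" (is "?L \<le> ?Q")
proof -
  define aa ab bb where "aa = (t1 * a1)\<^sup>2 + (t2 * a2)\<^sup>2 + (t3 * a3)\<^sup>2"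
    and "ab = t1\<^sup>2 * (a1 * b1) + t2\<^sup>2 * (a2 * b2) + t3\<^sup>2 * (a3 * b3)"
    and "bb = (t1 * b1)\<^sup>2 + (t2 * b2)\<^sup>2 + (t3 * b3)\<^sup>2"
  define B1 B2 B3 where "B1 = t2 * t3 * (a2 * b3 - a3 * b2)" and "B2 = t3 * t1 * (a3 * b1 - a1 * b3)"
    and "B3 = t1 * t2 * (a1 * b2 - a2 * b1)"
  have Lagrange: "aa * bb - ab\<^sup>2 = \<bar>B1\<bar>\<^sup>2 + \<bar>B2\<bar>\<^sup>2 + \<bar>B3\<bar>\<^sup>2"
    unfolding aa_def ab_def bb_def B1_def B2_def B3_def power2_abs
    by (simp add: algebra_simps power2_eq_square)
  have Q: "?Q = hh * bb + kk * aa - 2 * hk * ab"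
    unfolding aa_def ab_def bb_def by (simp add: algebra_simps power2_eq_square)
  have hk: "hk\<^sup>2 \<le> hh * kk" using O by (smt (verit) zero_le_power2)
  have L: "?L = 2 * (\<bar>O1\<bar> * \<bar>B1\<bar> + \<bar>O2\<bar> * \<bar>B2\<bar> + \<bar>O3\<bar> * \<bar>B3\<bar>)"
  proof -
    have "\<bar>B1\<bar> = t2 * t3 * \<bar>a2 * b3 - a3 * b2\<bar>" "\<bar>B2\<bar> = t3 * t1 * \<bar>a3 * b1 - a1 * b3\<bar>"
      "\<bar>B3\<bar> = t1 * t2 * \<bar>a1 * b2 - a2 * b1\<bar>"
      using t by (simp_all add: B1_def B2_def B3_def abs_mult)
    then show ?thesis by (simp add: abs_mult)
  qed
  have Qnn: "?Q \<ge> 0"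
  proof -
    have "a\<^sup>2 * kk - 2 * a * b * hk + b\<^sup>2 * hh \<ge> 0" for a b
    proof (cases "kk = 0")
      case True
      then have "hk = 0" using hk by simp
      then show ?thesis using hh by simp
    next
      case False
      have "kk * (a\<^sup>2 * kk - 2 * a * b * hk + b\<^sup>2 * hh) = (a * kk - b * hk)\<^sup>2 + b\<^sup>2 * (hh * kk - hk\<^sup>2)"
        by (simp add: algebra_simps power2_eq_square)
      also have "\<dots> \<ge> 0" using hk by simp
      finally show ?thesis using False hh by (simp add: zero_le_mult_iff)
    qed
    then show ?thesis by simp
  qed
  have "(\<bar>O1\<bar> * \<bar>B1\<bar> + \<bar>O2\<bar> * \<bar>B2\<bar> + \<bar>O3\<bar> * \<bar>B3\<bar>)\<^sup>2 \<le> (O1\<^sup>2 + O2\<^sup>2 + O3\<^sup>2) * (aa * bb - ab\<^sup>2)"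
    using three_term_Cauchy[of "\<bar>O1\<bar>" "\<bar>B1\<bar>" "\<bar>O2\<bar>" "\<bar>B2\<bar>" "\<bar>O3\<bar>" "\<bar>B3\<bar>"] by (simp add: Lagrange)
  also have "\<dots> \<le> (hh * kk - hk\<^sup>2) * (aa * bb - ab\<^sup>2)"
    using O by (intro mult_right_mono) (simp_all add: Lagrange)
  finally have "?L\<^sup>2 \<le> 4 * ((hh * kk - hk\<^sup>2) * (aa * bb - ab\<^sup>2))"
    unfolding L by (subst power_mult_distrib) simp
  also have "\<dots> \<le> ?Q\<^sup>2"
    unfolding Q using gram_mixed_discriminant[OF hh hk, of aa bb ab]
    by (simp add: aa_def bb_def algebra_simps)
  finally show ?thesis using Qnn by (rule power2_le_imp_le)
qed

text \<open>If some \<open>A_r\<close> or \<open>O_r\<close> is nonzero, one of the three binary forms is positive. Otherwise the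
form reduces to \<open>|h\<and>k|\<^sup>2 + \<Sum> t_r\<^sup>2 |a_r k - b_r h|\<^sup>2\<close>. If this vanishes too, the pair \<open>(b_r, - a_r)\<close> for
any \<open>r\<close>, or \<open>(|k|\<^sup>2, - \<langle>h, k\<rangle>)\<close> if all these are zero, is a linear relation between the two vectors.\<close>

lemma hopf_biquadratic_pos:
  fixes h k :: "quat ^ ('m::finite)"
  assumes t: "t1 > 0" "t2 > 0" "t3 > 0"
    and c: "curvature_condition t1 t2 t3" "curvature_condition t2 t3 t1" "curvature_condition t3 t1 t2"
    and indep: "\<And>l m. l *\<^sub>R h + m *\<^sub>R k = 0 \<Longrightarrow> l * a1 + m * b1 = 0 \<Longrightarrow> l * a2 + m * b2 = 0 \<Longrightarrow>
       l * a3 + m * b3 = 0 \<Longrightarrow> l = 0 \<and> m = 0"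
  shows "hopf_biquadratic t1 t2 t3 (h \<bullet> h) (h \<bullet> k) (k \<bullet> k) (k \<bullet> X1 h) (k \<bullet> X2 h) (k \<bullet> X3 h) a1 a2 a3 b1 b2 b3 > 0"
proof -
  define A1 A2 A3 where "A1 = a2 * b3 - a3 * b2" and "A2 = a3 * b1 - a1 * b3" and "A3 = a1 * b2 - a2 * b1"
  define O1 O2 O3 where "O1 = k \<bullet> X1 h" and "O2 = k \<bullet> X2 h" and "O3 = k \<bullet> X3 h"
  let ?F = "hopf_biquadratic t1 t2 t3 (h \<bullet> h) (h \<bullet> k) (k \<bullet> k) O1 O2 O3 a1 a2 a3 b1 b2 b3"
  let ?D = "(h \<bullet> h) * (k \<bullet> k) - (h \<bullet> k)\<^sup>2"
  let ?q = "\<lambda>a b. a\<^sup>2 * (k \<bullet> k) - 2 * a * b * (h \<bullet> k) + b\<^sup>2 * (h \<bullet> h)"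
  let ?E = "\<lambda>ti tj tk A W. V_coeff ti tj tk * A\<^sup>2 + H_coeff ti * W\<^sup>2 + 6 * (tj * tk - tj - tk + ti) * A * W
     + 2 * (tj * tk) * \<bar>A * W\<bar>"
  have bessel: "O1\<^sup>2 + O2\<^sup>2 + O3\<^sup>2 \<le> ?D"
    unfolding O1_def O2_def O3_def by (rule quaternionic_Bessel)
  have mixed: "2 * (t2 * t3) * \<bar>A1 * O1\<bar> + 2 * (t3 * t1) * \<bar>A2 * O2\<bar> + 2 * (t1 * t2) * \<bar>A3 * O3\<bar>
    \<le> t1\<^sup>2 * ?q a1 b1 + t2\<^sup>2 * ?q a2 b2 + t3\<^sup>2 * ?q a3 b3"
    unfolding A1_def A2_def A3_def by (rule mixed_term_bound[OF t _ _ bessel]) simp_all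
  have F: "?F = (?D - (O1\<^sup>2 + O2\<^sup>2 + O3\<^sup>2))
     + (V_coeff t1 t2 t3 * A1\<^sup>2 + H_coeff t1 * O1\<^sup>2 + 6 * (t2 * t3 - t2 - t3 + t1) * A1 * O1)
     + (V_coeff t2 t3 t1 * A2\<^sup>2 + H_coeff t2 * O2\<^sup>2 + 6 * (t3 * t1 - t3 - t1 + t2) * A2 * O2)
     + (V_coeff t3 t1 t2 * A3\<^sup>2 + H_coeff t3 * O3\<^sup>2 + 6 * (t1 * t2 - t1 - t2 + t3) * A3 * O3)
     + (t1\<^sup>2 * ?q a1 b1 + t2\<^sup>2 * ?q a2 b2 + t3\<^sup>2 * ?q a3 b3)"
    unfolding hopf_biquadratic_def Let_def A1_def[symmetric] A2_def[symmetric] A3_def[symmetric] H_coeff_def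
    by (simp add: left_diff_distrib right_diff_distrib)
  have bound: "?F \<ge> ?E t1 t2 t3 A1 O1 + ?E t2 t3 t1 A2 O2 + ?E t3 t1 t2 A3 O3"
    using F bessel mixed by linarith
  note E = curvature_condition_term[OF c(1), of A1 O1] curvature_condition_term[OF c(2), of A2 O2]
    curvature_condition_term[OF c(3), of A3 O3]
  show ?thesis
  proof (cases "A1 = 0 \<and> A2 = 0 \<and> A3 = 0 \<and> O1 = 0 \<and> O2 = 0 \<and> O3 = 0")
    case False
    then have "?E t1 t2 t3 A1 O1 > 0 \<or> ?E t2 t3 t1 A2 O2 > 0 \<or> ?E t3 t1 t2 A3 O3 > 0"
      using E(2,4,6) by blast
    moreover have "x \<ge> 0 \<Longrightarrow> y \<ge> 0 \<Longrightarrow> z \<ge> 0 \<Longrightarrow> x > 0 \<or> y > 0 \<or> z > 0 \<Longrightarrow> x + y + z > 0" for x y z :: real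
      by linarith
    ultimately have "?E t1 t2 t3 A1 O1 + ?E t2 t3 t1 A2 O2 + ?E t3 t1 t2 A3 O3 > 0"
      using E(1,3,5) by blast
    then show ?thesis using bound unfolding O1_def[symmetric] O2_def[symmetric] O3_def[symmetric]
      by (rule less_le_trans)
  next
    case True
    have q: "?q a b = norm (a *\<^sub>R k - b *\<^sub>R h) ^ 2" for a b
      unfolding power2_norm_eq_inner
        by (simp add: inner_expand inner_commute[of k h] algebra_simps power2_eq_square)
    have F0: "?F = ?D + (t1\<^sup>2 * ?q a1 b1 + t2\<^sup>2 * ?q a2 b2 + t3\<^sup>2 * ?q a3 b3)"
      using F True by simp
    have D: "?D \<ge> 0" using bessel True by simp
    have nn: "t1\<^sup>2 * ?q a1 b1 \<ge> 0" "t2\<^sup>2 * ?q a2 b2 \<ge> 0" "t3\<^sup>2 * ?q a3 b3 \<ge> 0"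
      unfolding q by simp_all
    have "?F > 0"
    proof (rule ccontr)
      assume "\<not> ?F > 0"
      then have "?D = 0" and "t1\<^sup>2 * ?q a1 b1 = 0" "t2\<^sup>2 * ?q a2 b2 = 0" "t3\<^sup>2 * ?q a3 b3 = 0"
        using F0 D nn by linarith+
      then have par: "b1 *\<^sub>R h + (- a1) *\<^sub>R k = 0" "b2 *\<^sub>R h + (- a2) *\<^sub>R k = 0" "b3 *\<^sub>R h + (- a3) *\<^sub>R k = 0"
        using t unfolding q by simp_all
      have "b1 = 0 \<and> a1 = 0" "b2 = 0 \<and> a2 = 0" "b3 = 0 \<and> a3 = 0"
        using indep[OF par(1)] indep[OF par(2)] indep[OF par(3)] True
        by (simp_all add: A1_def A2_def A3_def mult.commute)
      then have ind: "l *\<^sub>R h + m *\<^sub>R k = 0 \<Longrightarrow> l = 0 \<and> m = 0" for l m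
        using indep[of l m] by simp
      have "norm ((k \<bullet> k) *\<^sub>R h + (- (h \<bullet> k)) *\<^sub>R k) ^ 2 = (k \<bullet> k) * ?D"
        unfolding power2_norm_eq_inner
        by (simp add: inner_expand inner_commute[of k h] algebra_simps power2_eq_square)
      then have "(k \<bullet> k) *\<^sub>R h + (- (h \<bullet> k)) *\<^sub>R k = 0" using \<open>?D = 0\<close> by simp
      from ind[OF this] have "k = 0" by simp
      then show False using ind[of 0 1] by simp
    qed
    then show ?thesis unfolding O1_def O2_def O3_def .
  qed
qed

text \<open>The hypothesis \<open>pos\<close> is the value of the binary form at \<open>W = s = \<plusminus> 1\<close> and \<open>A = t_j t_k c\<^sup>2\<close>, in a form
that occurs as the curvature of a plane. Scaling \<open>A\<close> so that \<open>V A\<^sup>2 = H\<close> makes the comparison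
of arithmetic and geometric mean of \<open>V A\<^sup>2\<close> and \<open>H\<close> an equality, and \<open>s\<close> is chosen to make the \<open>\<tau>\<close>-term negative.\<close>

lemma curvature_condition_necessary:
  assumes t: "ti > 0" "tj > 0" "tk > 0" and V: "V_coeff ti tj tk > 0" and H: "H_coeff ti > 0"
    and pos: "\<And>c s. s \<in> {1, -1} \<Longrightarrow> H_coeff ti + V_coeff ti tj tk * (tj * tk * c\<^sup>2)\<^sup>2
       + 6 * (tj * tk - tj - tk + ti) * s * (tj * tk * c\<^sup>2) + 2 * (tj * tk) * (tj * tk * c\<^sup>2) > 0"
  shows "curvature_condition ti tj tk"
proof -
  let ?V = "V_coeff ti tj tk" and ?H = "H_coeff ti" and ?\<tau> = "tj * tk - tj - tk + ti"
  define u where "u = sqrt (?H / ?V)"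
  define c where "c = sqrt (u / (tj * tk))"
  have u: "u > 0" "?V * u\<^sup>2 = ?H" using V H by (simp_all add: u_def)
  have uc: "tj * tk * c\<^sup>2 = u" using u t by (simp add: c_def)
  define s :: real where "s = (if ?\<tau> \<ge> 0 then -1 else 1)"
  have s: "s \<in> {1, -1}" "?\<tau> * s = - \<bar>?\<tau>\<bar>" by (auto simp: s_def)
  have "?H + ?V * u\<^sup>2 + 6 * (?\<tau> * s) * u + 2 * (tj * tk) * u > 0"
    using pos[OF s(1), of c] unfolding uc by (simp only: mult.assoc)
  then have "2 * (u * (3 * \<bar>?\<tau>\<bar> - tj * tk)) < 2 * ?H"
    unfolding s(2) u(2) by (simp add: algebra_simps)
  moreover have "u * sqrt (?H * ?V) = ?H"
    using V H by (simp add: u_def real_sqrt_mult real_sqrt_divide)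
  ultimately have "u * (3 * \<bar>?\<tau>\<bar> - tj * tk) < u * sqrt (?H * ?V)" by simp
  then have "3 * \<bar>?\<tau>\<bar> - tj * tk < sqrt (?H * ?V)" using u(1) by simp
  then show ?thesis using V H unfolding curvature_condition_def by linarith
qed

section \<open>Positive curvature\<close>

lemma independent_pair_iff:
  fixes x y :: "'a::real_vector"
  shows "x \<noteq> y \<and> independent {x, y} \<longleftrightarrow> (\<forall>l m. l *\<^sub>R x + m *\<^sub>R y = 0 \<longrightarrow> l = 0 \<and> m = 0)"
proof
  assume *: "x \<noteq> y \<and> independent {x, y}"
  then have y: "y \<noteq> 0" and x: "x \<notin> span {y}"
    by (auto simp: independent_insert dependent_single)
  show "\<forall>l m. l *\<^sub>R x + m *\<^sub>R y = 0 \<longrightarrow> l = 0 \<and> m = 0"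
  proof (intro allI impI)
    fix l m assume eq: "l *\<^sub>R x + m *\<^sub>R y = 0"
    have "l = 0"
    proof (rule ccontr)
      assume "l \<noteq> 0"
      have "x = (1 / l) *\<^sub>R (l *\<^sub>R x)" using \<open>l \<noteq> 0\<close> by simp
      also have "l *\<^sub>R x = - (m *\<^sub>R y)" using eq by (simp add: eq_neg_iff_add_eq_0)
      finally have "x \<in> span {y}"
        by (metis span_base span_scale span_neg singletonI)
      then show False using x by simp
    qed
    then show "l = 0 \<and> m = 0" using eq y by simp
  qed
next
  assume *: "\<forall>l m. l *\<^sub>R x + m *\<^sub>R y = 0 \<longrightarrow> l = 0 \<and> m = 0"
  have y: "y \<noteq> 0" using *[rule_format, of 0 1] by auto
  have x: "x \<noteq> r *\<^sub>R y" for r using *[rule_format, of 1 "- r"] by auto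
  show "x \<noteq> y \<and> independent {x, y}"
    using y x x[of 1] by (auto simp: independent_insert dependent_single span_singleton)
qed

text \<open>The determinant times \<open>g(y, y)\<close> is \<open>g(z, z)\<close> for \<open>z = g(y, y) x - g(x, y) y\<close>.\<close>

lemma gram_determinant_pos:
  fixes g :: "'a::real_vector \<Rightarrow> 'a \<Rightarrow> real"
  assumes g: "bilinear g" "\<And>x y. g x y = g y x" "\<And>x. x \<noteq> 0 \<Longrightarrow> g x x > 0"
    and indep: "\<And>l m. l *\<^sub>R x + m *\<^sub>R y = 0 \<Longrightarrow> l = 0 \<and> m = 0"
  shows "g x x * g y y - (g x y)\<^sup>2 > 0"
proof -
  have "y \<noteq> 0" using indep[of 0 1] by auto
  then have gy: "g y y > 0" by (rule g(3))
  define z where "z = g y y *\<^sub>R x + (- g x y) *\<^sub>R y"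
  have "z \<noteq> 0" using indep[of "g y y" "- g x y"] gy unfolding z_def by fastforce
  then have "g z z > 0" by (rule g(3))
  also have "g z z = g y y * (g x x * g y y - (g x y)\<^sup>2)"
    unfolding z_def
    by (simp only: bilinear_ladd[OF g(1)] bilinear_radd[OF g(1)] bilinear_lmul[OF g(1)] bilinear_rmul[OF g(1)] g(2)[of y x])
      (simp add: algebra_simps power2_eq_square)
  finally show ?thesis using gy by (simp add: zero_less_mult_iff)
qed

text \<open>The denominator of the sectional curvature is positive, and every tangent vector extends to a field;
so only the sign of \<open>g(R(x, y) y, x)\<close> at single points matters.\<close>

lemma positive_sectional_curvature_hopf_iff:
  assumes t: "t1 > 0" "t2 > 0" "t3 > 0"
  shows "positive_sectional_curvature (hopf_metric t1 t2 t3 :: (quat ^ 'm::finite) metric) \<longleftrightarrow>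
    (\<forall>v\<in>sphere 0 1. \<forall>x y :: quat ^ 'm. x \<bullet> v = 0 \<longrightarrow> y \<bullet> v = 0 \<longrightarrow>
       (\<forall>l m. l *\<^sub>R x + m *\<^sub>R y = 0 \<longrightarrow> l = 0 \<and> m = 0) \<longrightarrow>
       hopf_metric t1 t2 t3 v (hopf_riemann t1 t2 t3 v x y y) x > 0)" (is "?L \<longleftrightarrow> ?R")
proof -
  let ?g = "hopf_metric t1 t2 t3 :: (quat ^ 'm) metric"
  have key: "sectional_curvature ?g X Y v > 0 \<longleftrightarrow> ?g v (hopf_riemann t1 t2 t3 v (X v) (Y v) (Y v)) (X v) > 0"
    if "vector_field X" "vector_field Y" "v \<in> sphere 0 1"
      "\<And>l m. l *\<^sub>R X v + m *\<^sub>R Y v = 0 \<Longrightarrow> l = 0 \<and> m = 0" for X Y v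
    using gram_determinant_pos[of "?g v" "X v" "Y v", OF hopf_metric_bilinear hopf_metric_sym hopf_metric_pos[OF t] that(4)]
    by (simp add: sectional_curvature_def curvature_tensor_hopf_metric[OF that(1,2,2,3) t] zero_less_divide_iff)
  show ?thesis
  proof
    assume L: ?L
    show ?R
    proof (intro ballI allI impI)
      fix v x y :: "quat ^ 'm"
      assume v: "v \<in> sphere 0 1" and xy: "x \<bullet> v = 0" "y \<bullet> v = 0"
        and indep: "\<forall>l m. l *\<^sub>R x + m *\<^sub>R y = 0 \<longrightarrow> l = 0 \<and> m = 0"
      obtain X where X: "vector_field X" "X v = x" by (rule vector_field_through[OF v xy(1)])
      obtain Y where Y: "vector_field Y" "Y v = y" by (rule vector_field_through[OF v xy(2)])
      have "sectional_curvature ?g X Y v > 0"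
        using L indep X Y v unfolding positive_sectional_curvature_def independent_pair_iff by blast
      then show "?g v (hopf_riemann t1 t2 t3 v x y y) x > 0"
        using key[OF X(1) Y(1) v] indep X(2) Y(2) by auto
    qed
  next
    assume R: ?R
    show ?L
      unfolding positive_sectional_curvature_def independent_pair_iff
    proof (intro allI impI ballI)
      fix X Y :: "quat ^ 'm \<Rightarrow> quat ^ 'm" and v :: "quat ^ 'm"
      assume "vector_field X" "vector_field Y" "v \<in> sphere 0 1"
        "\<forall>l m. l *\<^sub>R X v + m *\<^sub>R Y v = 0 \<longrightarrow> l = 0 \<and> m = 0"
      then show "sectional_curvature ?g X Y v > 0"
        using R key vector_fieldD(2) by blast
    qed
  qed
qed

text \<open>Two different coordinate vectors span orthogonal quaternionic lines. On a single line the sphere would be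
one fiber, without horizontal vectors.\<close>

lemma exists_horizontal_unit_vector:
  assumes "CARD('m::finite) \<ge> 2"
  obtains v e :: "quat ^ 'm" where "v \<in> sphere 0 1" "e \<bullet> e = 1"
    "e \<bullet> v = 0" "e \<bullet> X1 v = 0" "e \<bullet> X2 v = 0" "e \<bullet> X3 v = 0"
proof -
  obtain p q :: 'm where pq: "p \<noteq> q"
    using assms by (metis UNIV_I card_le_Suc0_iff_eq finite not_less_eq_eq numeral_2_eq_2)
  let ?one = "(1, 0, 0, 0) :: quat"
  have fib: "axis q ?one \<bullet> fiber_field u (axis p ?one) = 0" for u
    using pq by (cases u) (auto simp: inner_vec_def axis_def fiber_field_def right_mult_def qmult_def
        inner_prod_def zero_prod_def intro!: sum.neutral)
  show ?thesis
    by (rule that[of "axis p ?one" "axis q ?one"])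
      (use pq in \<open>simp_all add: fib norm_eq_sqrt_inner inner_axis_axis inner_prod_def\<close>)
qed

theorem theoremB:
  fixes n :: nat and t1 t2 t3 :: real
  assumes "n \<ge> 1" and "CARD('m::finite) = n + 1"
    and "t1 > 0" and "t2 > 0" and "t3 > 0"
  shows "positive_sectional_curvature (hopf_metric t1 t2 t3 :: (quat ^ 'm) metric) \<longleftrightarrow>
    (\<forall>(ti, tj, tk) \<in> {(t1, t2, t3), (t2, t3, t1), (t3, t1, t2)}.
       V_coeff ti tj tk > 0 \<and> H_coeff ti > 0 \<and>
       3 * \<bar>tj * tk - tj - tk + ti\<bar> < tj * tk + sqrt (H_coeff ti * V_coeff ti tj tk))"
proof -
  note t = assms(3-5)
  let ?g = "hopf_metric t1 t2 t3 :: (quat ^ 'm) metric"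
  have "positive_sectional_curvature ?g \<longleftrightarrow>
    curvature_condition t1 t2 t3 \<and> curvature_condition t2 t3 t1 \<and> curvature_condition t3 t1 t2"
  proof
    assume c: "curvature_condition t1 t2 t3 \<and> curvature_condition t2 t3 t1 \<and> curvature_condition t3 t1 t2"
    show "positive_sectional_curvature ?g"
      unfolding positive_sectional_curvature_hopf_iff[OF t]
    proof (intro ballI allI impI)
      fix v x y :: "quat ^ 'm"
      assume v: "v \<in> sphere 0 1" and xy: "x \<bullet> v = 0" "y \<bullet> v = 0"
        and indep: "\<forall>l m. l *\<^sub>R x + m *\<^sub>R y = 0 \<longrightarrow> l = 0 \<and> m = 0"
      have vv: "v \<bullet> v = 1" using v by (simp add: dot_square_norm)
      let ?P = "horizontal_part v"
      have split: "z = ?P z + (z \<bullet> X1 v) *\<^sub>R X1 v + (z \<bullet> X2 v) *\<^sub>R X2 v + (z \<bullet> X3 v) *\<^sub>R X3 v" for z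
        by (simp add: horizontal_part_def)
      have hor: "?P z \<bullet> v = 0" "?P z \<bullet> X1 v = 0" "?P z \<bullet> X2 v = 0" "?P z \<bullet> X3 v = 0" if "z \<bullet> v = 0" for z
        by (simp_all add: horizontal_part_def inner_expand that fiber_field_tangent fiber_field_skew
            fiber_field_compose inner_fiber_field_self vv)
      show "?g v (hopf_riemann t1 t2 t3 v x y y) x > 0"
        unfolding hopf_curvature_formula[OF v t hor[OF xy(1)] hor[OF xy(2)] split split]
      proof (rule hopf_biquadratic_pos[OF t])
        fix l m :: real
        assume z: "l *\<^sub>R ?P x + m *\<^sub>R ?P y = 0" "l * (x \<bullet> X1 v) + m * (y \<bullet> X1 v) = 0"
          "l * (x \<bullet> X2 v) + m * (y \<bullet> X2 v) = 0" "l * (x \<bullet> X3 v) + m * (y \<bullet> X3 v) = 0"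
        have "l *\<^sub>R x + m *\<^sub>R y = (l *\<^sub>R ?P x + m *\<^sub>R ?P y)
          + (l * (x \<bullet> X1 v) + m * (y \<bullet> X1 v)) *\<^sub>R X1 v + (l * (x \<bullet> X2 v) + m * (y \<bullet> X2 v)) *\<^sub>R X2 v
          + (l * (x \<bullet> X3 v) + m * (y \<bullet> X3 v)) *\<^sub>R X3 v"
          by (simp add: horizontal_part_def algebra_simps)
        also have "\<dots> = 0" unfolding z by simp
        finally show "l = 0 \<and> m = 0" using indep by blast
      qed (use c in auto)
    qed
  next
    assume pos: "positive_sectional_curvature ?g"
    have "CARD('m) \<ge> 2" using assms(1,2) by simp
    then obtain v e :: "quat ^ 'm" where v: "v \<in> sphere 0 1" and ee: "e \<bullet> e = 1"
      and e: "e \<bullet> v = 0" "e \<bullet> X1 v = 0" "e \<bullet> X2 v = 0" "e \<bullet> X3 v = 0"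
      by (rule exists_horizontal_unit_vector)
    have vv: "v \<bullet> v = 1" using v by (simp add: dot_square_norm)
    define hor where "hor h \<longleftrightarrow> h \<bullet> v = 0 \<and> h \<bullet> X1 v = 0 \<and> h \<bullet> X2 v = 0 \<and> h \<bullet> X3 v = 0" for h
    have hor: "hor 0" "hor e" "hor (r *\<^sub>R X1 e)" "hor (r *\<^sub>R X2 e)" "hor (r *\<^sub>R X3 e)" for r
      using e by (simp_all add: hor_def fiber_field_skew fiber_field_compose)
    have F: "hopf_biquadratic t1 t2 t3 (h \<bullet> h) (h \<bullet> k) (k \<bullet> k) (k \<bullet> X1 h) (k \<bullet> X2 h) (k \<bullet> X3 h) a1 a2 a3 b1 b2 b3 > 0"
      if h: "hor h" and k: "hor k"
      and indep: "\<And>l m. l *\<^sub>R h + m *\<^sub>R k = 0 \<Longrightarrow> l * a1 + m * b1 = 0 \<Longrightarrow> l * a2 + m * b2 = 0 \<Longrightarrow>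
       l * a3 + m * b3 = 0 \<Longrightarrow> l = 0 \<and> m = 0" for h k a1 a2 a3 b1 b2 b3
    proof -
      let ?x = "h + a1 *\<^sub>R X1 v + a2 *\<^sub>R X2 v + a3 *\<^sub>R X3 v"
      let ?y = "k + b1 *\<^sub>R X1 v + b2 *\<^sub>R X2 v + b3 *\<^sub>R X3 v"
      have "l = 0 \<and> m = 0" if z: "l *\<^sub>R ?x + m *\<^sub>R ?y = 0" for l m
      proof (rule indep)
        have "(l *\<^sub>R ?x + m *\<^sub>R ?y) \<bullet> X1 v = 0" "(l *\<^sub>R ?x + m *\<^sub>R ?y) \<bullet> X2 v = 0" "(l *\<^sub>R ?x + m *\<^sub>R ?y) \<bullet> X3 v = 0"
          unfolding z by simp_all
        then show c: "l * a1 + m * b1 = 0" "l * a2 + m * b2 = 0" "l * a3 + m * b3 = 0"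
          using h k by (simp_all add: hor_def inner_expand fiber_field_skew fiber_field_compose inner_fiber_field_self vv)
        have "l *\<^sub>R ?x + m *\<^sub>R ?y = l *\<^sub>R h + m *\<^sub>R k + (l * a1 + m * b1) *\<^sub>R X1 v
            + (l * a2 + m * b2) *\<^sub>R X2 v + (l * a3 + m * b3) *\<^sub>R X3 v"
          by (simp add: algebra_simps)
        then show "l *\<^sub>R h + m *\<^sub>R k = 0" unfolding z c by simp
      qed
      moreover have "?x \<bullet> v = 0" "?y \<bullet> v = 0"
        using h k by (simp_all add: hor_def inner_expand fiber_field_tangent)
      ultimately have "?g v (hopf_riemann t1 t2 t3 v ?x ?y ?y) ?x > 0"
        using pos v unfolding positive_sectional_curvature_hopf_iff[OF t] by blast
      then show ?thesis
        using h k by (subst (asm) hopf_curvature_formula[OF v t _ _ _ _ _ _ _ _ refl refl]) (auto simp: hor_def)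
    qed
    have [simp]: "e \<noteq> 0" using ee by auto
    \<comment> \<open>the vertical planes spanned by two of the fiber fields\<close>
    have V: "V_coeff t1 t2 t3 > 0" "V_coeff t2 t3 t1 > 0" "V_coeff t3 t1 t2 > 0"
      using F[OF hor(1) hor(1), of 0 0 1 0 0 1] F[OF hor(1) hor(1), of 0 1 0 0 1 0] F[OF hor(1) hor(1), of 1 0 0 1 0 0]
      by (simp_all add: hopf_biquadratic_def fiber_field_linear)
    have ind: "l *\<^sub>R e + m *\<^sub>R (s *\<^sub>R X1 e) = 0 \<Longrightarrow> l = 0 \<and> m = 0"
      "l *\<^sub>R e + m *\<^sub>R (s *\<^sub>R X2 e) = 0 \<Longrightarrow> l = 0 \<and> m = 0"
      "l *\<^sub>R e + m *\<^sub>R (s *\<^sub>R X3 e) = 0 \<Longrightarrow> l = 0 \<and> m = 0"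
      if "s \<in> {1, -1}" for l m s :: real
    proof -
      have *: "l = 0 \<and> m = 0" if z: "l *\<^sub>R e + m *\<^sub>R (s *\<^sub>R f) = 0" and f: "f \<bullet> f = 1" "e \<bullet> f = 0" for f
      proof -
        have "(l *\<^sub>R e + m *\<^sub>R (s *\<^sub>R f)) \<bullet> e = 0" "(l *\<^sub>R e + m *\<^sub>R (s *\<^sub>R f)) \<bullet> f = 0"
          unfolding z by simp_all
        then show ?thesis
          using f ee \<open>s \<in> {1, -1}\<close> by (auto simp: inner_expand inner_commute[of f e])
      qed
      show "l *\<^sub>R e + m *\<^sub>R (s *\<^sub>R X1 e) = 0 \<Longrightarrow> l = 0 \<and> m = 0"
        "l *\<^sub>R e + m *\<^sub>R (s *\<^sub>R X2 e) = 0 \<Longrightarrow> l = 0 \<and> m = 0"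
        "l *\<^sub>R e + m *\<^sub>R (s *\<^sub>R X3 e) = 0 \<Longrightarrow> l = 0 \<and> m = 0"
        using * by (auto simp: fiber_field_inner_self ee inner_fiber_field_self)
    qed
    \<comment> \<open>the planes spanned by \<open>e + c t_k X_j\<close> and \<open>\<plusminus> X_i e + c t_j X_k\<close>, on which both inequalities of the
      sufficiency proof are equalities\<close>
    have T1: "H_coeff t1 + V_coeff t1 t2 t3 * (t2 * t3 * c\<^sup>2)\<^sup>2
       + 6 * (t2 * t3 - t2 - t3 + t1) * s * (t2 * t3 * c\<^sup>2) + 2 * (t2 * t3) * (t2 * t3 * c\<^sup>2) > 0"
      if "s \<in> {1, -1}" for c s
    proof -
      let ?k = "s *\<^sub>R X1 e"
      have "0 < hopf_biquadratic t1 t2 t3 (e \<bullet> e) (e \<bullet> ?k) (?k \<bullet> ?k) (?k \<bullet> X1 e) (?k \<bullet> X2 e) (?k \<bullet> X3 e)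
          0 (t3 * c) 0 0 0 (t2 * c)"
        by (rule F[OF hor(2) hor(3)]) (use ind(1)[OF that] in blast)
      also have "\<dots> = H_coeff t1 + V_coeff t1 t2 t3 * (t2 * t3 * c\<^sup>2)\<^sup>2
       + 6 * (t2 * t3 - t2 - t3 + t1) * s * (t2 * t3 * c\<^sup>2) + 2 * (t2 * t3) * (t2 * t3 * c\<^sup>2)"
        using that by (auto simp: hopf_biquadratic_def H_coeff_def fiber_field_skew fiber_field_compose
            inner_fiber_field_self ee algebra_simps power2_eq_square)
      finally show ?thesis .
    qed
    have T2: "H_coeff t2 + V_coeff t2 t3 t1 * (t3 * t1 * c\<^sup>2)\<^sup>2
       + 6 * (t3 * t1 - t3 - t1 + t2) * s * (t3 * t1 * c\<^sup>2) + 2 * (t3 * t1) * (t3 * t1 * c\<^sup>2) > 0"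
      if "s \<in> {1, -1}" for c s
    proof -
      let ?k = "s *\<^sub>R X2 e"
      have "0 < hopf_biquadratic t1 t2 t3 (e \<bullet> e) (e \<bullet> ?k) (?k \<bullet> ?k) (?k \<bullet> X1 e) (?k \<bullet> X2 e) (?k \<bullet> X3 e)
          0 0 (t1 * c) (t3 * c) 0 0"
        by (rule F[OF hor(2) hor(4)]) (use ind(2)[OF that] in blast)
      also have "\<dots> = H_coeff t2 + V_coeff t2 t3 t1 * (t3 * t1 * c\<^sup>2)\<^sup>2
       + 6 * (t3 * t1 - t3 - t1 + t2) * s * (t3 * t1 * c\<^sup>2) + 2 * (t3 * t1) * (t3 * t1 * c\<^sup>2)"
        using that by (auto simp: hopf_biquadratic_def H_coeff_def fiber_field_skew fiber_field_compose
            inner_fiber_field_self ee algebra_simps power2_eq_square)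
      finally show ?thesis .
    qed
    have T3: "H_coeff t3 + V_coeff t3 t1 t2 * (t1 * t2 * c\<^sup>2)\<^sup>2
       + 6 * (t1 * t2 - t1 - t2 + t3) * s * (t1 * t2 * c\<^sup>2) + 2 * (t1 * t2) * (t1 * t2 * c\<^sup>2) > 0"
      if "s \<in> {1, -1}" for c s
    proof -
      let ?k = "s *\<^sub>R X3 e"
      have "0 < hopf_biquadratic t1 t2 t3 (e \<bullet> e) (e \<bullet> ?k) (?k \<bullet> ?k) (?k \<bullet> X1 e) (?k \<bullet> X2 e) (?k \<bullet> X3 e)
          (t2 * c) 0 0 0 (t1 * c) 0"
        by (rule F[OF hor(2) hor(5)]) (use ind(3)[OF that] in blast)
      also have "\<dots> = H_coeff t3 + V_coeff t3 t1 t2 * (t1 * t2 * c\<^sup>2)\<^sup>2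
       + 6 * (t1 * t2 - t1 - t2 + t3) * s * (t1 * t2 * c\<^sup>2) + 2 * (t1 * t2) * (t1 * t2 * c\<^sup>2)"
        using that by (auto simp: hopf_biquadratic_def H_coeff_def fiber_field_skew fiber_field_compose
            inner_fiber_field_self ee algebra_simps power2_eq_square)
      finally show ?thesis .
    qed
    \<comment> \<open>for \<open>c = 0\<close> these planes are horizontal\<close>
    have H: "H_coeff t1 > 0" "H_coeff t2 > 0" "H_coeff t3 > 0"
      using T1[of 1 0] T2[of 1 0] T3[of 1 0] by simp_all
    show "curvature_condition t1 t2 t3 \<and> curvature_condition t2 t3 t1 \<and> curvature_condition t3 t1 t2"
      using curvature_condition_necessary[OF t V(1) H(1) T1] curvature_condition_necessary[OF t(2,3,1) V(2) H(2) T2]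
        curvature_condition_necessary[OF t(3,1,2) V(3) H(3) T3] by blast
  qed
  then show ?thesis by (simp add: curvature_condition_def)
qed

end
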